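(* Let $\mathcal M=(K_{i(e)},w_e,p_e)_{e\in E}$ be a Markov system on a complete metric space $(K,d)$ which is positive and contractive with a contraction rate $0<a<1$. Let $x,y\in K_i$ for some $i\in N$ and $0\le\beta\le1$. Then the following holds. (i) $$B_{\beta xy}\le\sum_{k=0}^\infty\left(\hat\ell_{xk}\,a^{(1-\beta)k}+\hat\phi^{(\beta k)}_{xy}\right).$$ (ii) $$B_{\beta xy}\le\sum_{k=0}^\infty\hat\ell_{xk}\left(a^{(1-\beta)k}+\phi_{\mathcal M}^2\left(a^{\beta k}d(x,y)\right)\right).$$ (iii) If each $w_e|_{K_{i(e)}}$, $e\in E$, is contractive with the contraction rate $a$ (i.e. $d(w_eu,w_ev)\le a\,d(u,v)$ for all $u,v\in K_{i(e)}$), then $$B_{\beta xy}\le\sum_{k=0}^\infty\hat\ell_{xk}\,\phi_{\mathcal M}^2\left(a^{\beta k}d(x,y)\right).$$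
   Context: Markov system. A Markov system $\mathcal M=(K_{i(e)},w_e,p_e)_{e\in E}$ on a complete metric space $(K,d)$ consists of: an at most countable set $E$; Borel measurable maps $w_e:K\to K$ and Borel measurable functions $p_e:K\to[0,1]$ ($e\in E$) with $\sum_{e\in E}p_e(x)=1$ for all $x\in K$; a partition $(K_i)_{i\in N}$ of $K$ into non-empty Borel sets; and maps $i,t:E\to N$, with $i$ surjective (so $N$ is at most countable), such that $\emptyset\neq\{p_e>0\}\subset K_{i(e)}$ and $w_e(K_{i(e)})\subset K_{t(e)}$ for all $e\in E$. It is positive if $p_e>0$ on $K_{i(e)}$ for all $e$; contractive with contraction rate $a$ ($0<a<1$) if $\sum_{e\in E,\,i(e)=j}p_e(x)d(w_ex,w_ey)\le a\,d(x,y)$ for all $x,y\in K_j$, $j\in N$. $U$ is the operator $Uf:=\sum_{e\in E}p_e\,f\circ w_e$ on non-negative Borel functions, and $U^*\nu(f):=\int Uf\,d\nu$ for Borel probability measures $\nu$ on $K$. Paths. $(e_1,\dots,e_k)\in E^k$ is a path of length $k\ge1$ if $i(e_{m+1})=t(e_m)$ for $1\le m\le k-1$; $j\in N$ is accessible from $i\in N$ by a path of length $k\geq 1$ if there is such a path with $i(e_1)=i$, $t(e_k)=j$; by a path of length $0$ only $j=i$ is accessible from $i$. Path measures. Let $\bar E=E\cup\{\infty\}$ be the one-point compactification of the discrete space $E$, with $w_\infty:=\mathrm{id}$, $p_\infty:=0$, and $\Sigma^+:=\bar E^{\mathbb N}$ with product topology and Borel $\sigma$-algebra; ${}_1[e_1,\dots,e_k]^+:=\{\sigma\in\Sigma^+:\sigma_1=e_1,\dots,\sigma_k=e_k\}$.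 $\Sigma_G^+:=\{\sigma\in\Sigma^+:\sigma_n\in E,\ i(\sigma_{n+1})=t(\sigma_n)\ \forall n\in\mathbb N\}$. For $x\in K$, $P_x$ is the Borel probability measure on $\Sigma^+$ with $P_x({}_1[e_1,\dots,e_k]^+)=p_{e_1}(x)p_{e_2}(w_{e_1}x)\cdots p_{e_k}(w_{e_{k-1}}\circ\cdots\circ w_{e_1}x)$. The quantities in the claim. For $e\in E$, $s\ge0$, let $\phi_e(s):=\sup\{|p_e(u)-p_e(v)|:u,v\in K_{i(e)},\ d(u,v)\le s\}$ and $\phi_{\mathcal M}(s):=\sup_{e\in E}\phi_e(s)$. For $x,y\in K_i$, $j\in N$, $0\le\beta\le1$, let $$A_{xy}^{(\beta k)}:=\left\{\sigma\in\Sigma^+_G:d(w_{\sigma_k}\circ\cdots\circ w_{\sigma_1}x,\,w_{\sigma_k}\circ\cdots\circ w_{\sigma_1}y)>a^{\beta k}d(x,y)\right\}\quad(k\ge1),$$ and for $k=0$: $A_{xy}^{(\beta0)}:=\Sigma_G^+$ if at least one of the maps $w_e|_{K_{i(e)}}$, $e\in E$, is not a contraction (Lipschitz with constant $<1$), and $A_{xy}^{(\beta0)}:=\emptyset$ otherwise. Let $$\ell_j:=\sup_{z\in K_j}\sum_{e\in E,\,i(e)=j}\frac1{p_e(z)},\qquad \phi^{(\beta k)}_{xyj}:=\sup_{z\in K_j}\sum_{e\in E,\,i(e)=j}\frac{\phi_e^2\left(a^{\beta k}d(x,y)\right)}{p_e(z)}\quad(k\ge0),$$ $$B_{\beta xy}:=\sum_{k=0}^\infty\sum_{j\in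 N}\left(\ell_j\int_{A_{xy}^{(\beta k)}}1_{K_j}\left(w_{\sigma_k}\circ\cdots\circ w_{\sigma_1}(x)\right)dP_x(\sigma)+\phi^{(\beta k)}_{xyj}\,(U^* )^k\delta_x(K_j)\right),$$ and for $k\ge0$ $$\hat\ell_{xk}:=\sup\{\ell_j: j\text{ is accessible from }i\text{ by a path of length }k\},$$ $$\hat\phi^{(\beta k)}_{xy}:=\sup\{\phi^{(\beta k)}_{xyj}: j\text{ is accessible from }i\text{ by a path of length }k\}.$$ For $k=0$ the empty composition is the identity and $(U^* )^0\delta_x=\delta_x$. All quantities take values in $[0,\infty]$ with $0\cdot\infty:=0$. *)

theory Defs
  imports "HOL-Probability.Probability"
begin

section \<open>Markov systems\<close>

text \<open>The complete metric space \<open>(K, d)\<close> is a type \<open>'k\<close> of class \<^class>\<open>complete_space\<close>; edges and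
  vertices are sets in arbitrary types. The fields \<open>ini\<close>, \<open>ter\<close> are the maps \<open>i\<close>, \<open>t\<close>, and \<open>wmap\<close>,
  \<open>wgt\<close> are the families \<open>w\<close>, \<open>p\<close>.\<close>

record ('k, 'e, 'n) markov_data =
  Edges :: "'e set"
  Verts :: "'n set"
  cell :: "'n \<Rightarrow> 'k set"
  ini :: "'e \<Rightarrow> 'n"
  ter :: "'e \<Rightarrow> 'n"
  wmap :: "'e \<Rightarrow> 'k \<Rightarrow> 'k"
  wgt :: "'e \<Rightarrow> 'k \<Rightarrow> real"

locale Markov_system =
  fixes M :: "('k::complete_space, 'e, 'n) markov_data"
  assumes countable_Edges: "countable (Edges M)"
    and wmap_measurable: "e \<in> Edges M \<Longrightarrow> wmap M e \<in> borel \<rightarrow>\<^sub>M borel"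
    and wgt_measurable: "e \<in> Edges M \<Longrightarrow> wgt M e \<in> borel_measurable borel"
    and wgt_range: "e \<in> Edges M \<Longrightarrow> wgt M e x \<in> {0..1}"
    and wgt_sum: "((\<lambda>e. wgt M e x) has_sum 1) (Edges M)"
    and cell_nonempty: "j \<in> Verts M \<Longrightarrow> cell M j \<noteq> {}"
    and cell_borel: "j \<in> Verts M \<Longrightarrow> cell M j \<in> sets borel"
    and cell_disjoint: "disjoint_family_on (cell M) (Verts M)"
    and cell_cover: "(\<Union>j\<in>Verts M. cell M j) = UNIV"
    and ini_surj: "ini M ` Edges M = Verts M"
    and ter_range: "ter M ` Edges M \<subseteq> Verts M"
    and wgt_nonzero: "e \<in> Edges M \<Longrightarrow> {x. wgt M e x > 0} \<noteq> {}"
    and wgt_support: "e \<in> Edges M \<Longrightarrow> {x. wgt M e x > 0} \<subseteq> cell M (ini M e)"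
    and wmap_cell: "e \<in> Edges M \<Longrightarrow> wmap M e ` cell M (ini M e) \<subseteq> cell M (ter M e)"

definition positive_system :: "('k::complete_space, 'e, 'n) markov_data \<Rightarrow> bool" where
  "positive_system M \<longleftrightarrow> (\<forall>e\<in>Edges M. \<forall>x\<in>cell M (ini M e). wgt M e x > 0)"

definition out_edges :: "('k, 'e, 'n) markov_data \<Rightarrow> 'n \<Rightarrow> 'e set" where
  "out_edges M j = {e \<in> Edges M. ini M e = j}"

text \<open>Possibly infinite sums of non-negative terms are taken in \<^typ>\<open>ennreal\<close>, where every family is
  summable, so that the inequality below includes convergence of its left-hand side.\<close>

definition contractive_system :: "('k::complete_space, 'e, 'n) markov_data \<Rightarrow> real \<Rightarrow> bool" where
  "contractive_system M a \<longleftrightarrow>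
     0 < a \<and> a < 1 \<and>
     (\<forall>j\<in>Verts M. \<forall>x\<in>cell M j. \<forall>y\<in>cell M j.
        (\<Sum>\<^sub>\<infinity>e\<in>out_edges M j. ennreal (wgt M e x) * ennreal (dist (wmap M e x) (wmap M e y)))
          \<le> ennreal (a * dist x y))"

definition U_op :: "('k::complete_space, 'e, 'n) markov_data \<Rightarrow> ('k \<Rightarrow> ennreal) \<Rightarrow> 'k \<Rightarrow> ennreal" where
  "U_op M f x = (\<Sum>\<^sub>\<infinity>e\<in>Edges M. ennreal (wgt M e x) * f (wmap M e x))"

definition U_adj :: "('k::complete_space, 'e, 'n) markov_data \<Rightarrow> 'k measure \<Rightarrow> 'k measure" where
  "U_adj M \<nu> = measure_of UNIV (sets borel) (\<lambda>A. \<integral>\<^sup>+x. U_op M (indicator A) x \<partial>\<nu>)"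


section \<open>Paths and path measures\<close>

definition is_path :: "('k, 'e, 'n) markov_data \<Rightarrow> 'e list \<Rightarrow> bool" where
  "is_path M es \<longleftrightarrow> es \<noteq> [] \<and> set es \<subseteq> Edges M \<and>
     (\<forall>m. Suc m < length es \<longrightarrow> ini M (es ! Suc m) = ter M (es ! m))"

definition accessible :: "('k, 'e, 'n) markov_data \<Rightarrow> nat \<Rightarrow> 'n \<Rightarrow> 'n \<Rightarrow> bool" where
  "accessible M k i j \<longleftrightarrow>
     (if k = 0 then j = i
      else \<exists>es. is_path M es \<and> length es = k \<and> ini M (hd es) = i \<and> ter M (last es) = j)"

text \<open>\<^const>\<open>None\<close> is the point \<open>\<infinity>\<close> of the one-point compactification of \<open>E\<close>. Sequences are indexed
  from \<open>0\<close>, so \<open>\<sigma> n\<close> is the letter \<open>\<sigma>\<^sub>n\<^sub>+\<^sub>1\<close>, and \<open>wcomp M \<sigma> k\<close> applies the maps of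
  the first \<open>k\<close> letters.\<close>

definition wbar :: "('k, 'e, 'n) markov_data \<Rightarrow> 'e option \<Rightarrow> 'k \<Rightarrow> 'k" where
  "wbar M c = (case c of None \<Rightarrow> id | Some e \<Rightarrow> wmap M e)"

definition pbar :: "('k, 'e, 'n) markov_data \<Rightarrow> 'e option \<Rightarrow> 'k \<Rightarrow> real" where
  "pbar M c = (case c of None \<Rightarrow> (\<lambda>_. 0) | Some e \<Rightarrow> wgt M e)"

primrec wcomp :: "('k, 'e, 'n) markov_data \<Rightarrow> (nat \<Rightarrow> 'e option) \<Rightarrow> nat \<Rightarrow> 'k \<Rightarrow> 'k" where
  "wcomp M \<sigma> 0 = id"
| "wcomp M \<sigma> (Suc k) = wbar M (\<sigma> k) \<circ> wcomp M \<sigma> k"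

definition Ebar_top :: "('k, 'e, 'n) markov_data \<Rightarrow> 'e option topology" where
  "Ebar_top M = Alexandroff_compactification (discrete_topology (Edges M))"

definition Sigma_top :: "('k, 'e, 'n) markov_data \<Rightarrow> (nat \<Rightarrow> 'e option) topology" where
  "Sigma_top M = product_topology (\<lambda>_. Ebar_top M) UNIV"

definition borel_of :: "'a topology \<Rightarrow> 'a measure" where
  "borel_of X = sigma (topspace X) {U. openin X U}"

definition cylinder :: "('k, 'e, 'n) markov_data \<Rightarrow> 'e option list \<Rightarrow> (nat \<Rightarrow> 'e option) set" where
  "cylinder M cs = {\<sigma> \<in> topspace (Sigma_top M). \<forall>m<length cs. \<sigma> m = cs ! m}"

definition Sigma_G :: "('k, 'e, 'n) markov_data \<Rightarrow> (nat \<Rightarrow> 'e option) set" where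
  "Sigma_G M = {\<sigma>. \<exists>s. (\<forall>n. \<sigma> n = Some (s n)) \<and> (\<forall>n. s n \<in> Edges M) \<and>
                       (\<forall>n. ini M (s (Suc n)) = ter M (s n))}"

definition is_path_measure ::
    "('k, 'e, 'n) markov_data \<Rightarrow> 'k \<Rightarrow> (nat \<Rightarrow> 'e option) measure \<Rightarrow> bool" where
  "is_path_measure M x P \<longleftrightarrow>
     prob_space P \<and> sets P = sets (borel_of (Sigma_top M)) \<and>
     (\<forall>cs. set cs \<subseteq> topspace (Ebar_top M) \<longrightarrow>
        emeasure P (cylinder M cs) =
          ennreal (\<Prod>m<length cs. pbar M (cs ! m) (wcomp M ((!) cs) m x)))"

text \<open>Existence and uniqueness of the path measure of a Markov system is shown at the end of this
  theory.\<close>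

definition path_measure :: "('k, 'e, 'n) markov_data \<Rightarrow> 'k \<Rightarrow> (nat \<Rightarrow> 'e option) measure" where
  "path_measure M x = (THE P. is_path_measure M x P)"


section \<open>The quantities in the estimate\<close>

definition phi_edge :: "('k::complete_space, 'e, 'n) markov_data \<Rightarrow> 'e \<Rightarrow> real \<Rightarrow> ennreal" where
  "phi_edge M e s =
     Sup {ennreal \<bar>wgt M e u - wgt M e v\<bar> | u v.
            u \<in> cell M (ini M e) \<and> v \<in> cell M (ini M e) \<and> dist u v \<le> s}"

definition phi_system :: "('k::complete_space, 'e, 'n) markov_data \<Rightarrow> real \<Rightarrow> ennreal" where
  "phi_system M s = (SUP e\<in>Edges M. phi_edge M e s)"

definition A_set :: "('k::complete_space, 'e, 'n) markov_data \<Rightarrow> real \<Rightarrow> real \<Rightarrow> nat \<Rightarrow> 'k \<Rightarrow> 'k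
    \<Rightarrow> (nat \<Rightarrow> 'e option) set" where
  "A_set M a \<beta> k x y =
     (if k = 0 then
        (if \<exists>e\<in>Edges M. \<not> (\<exists>L<1. L-lipschitz_on (cell M (ini M e)) (wmap M e))
         then Sigma_G M else {})
      else {\<sigma> \<in> Sigma_G M.
              dist (wcomp M \<sigma> k x) (wcomp M \<sigma> k y) > a powr (\<beta> * real k) * dist x y})"

text \<open>Division in \<^typ>\<open>ennreal\<close>: \<open>1 / 0 = \<infinity>\<close> and \<open>0 / 0 = 0\<close>; also \<open>0 * \<infinity> = 0\<close>.\<close>

definition ell :: "('k::complete_space, 'e, 'n) markov_data \<Rightarrow> 'n \<Rightarrow> ennreal" where
  "ell M j = (SUP z\<in>cell M j. \<Sum>\<^sub>\<infinity>e\<in>out_edges M j. 1 / ennreal (wgt M e z))"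

definition phi_vert :: "('k::complete_space, 'e, 'n) markov_data \<Rightarrow> real \<Rightarrow> real \<Rightarrow> nat \<Rightarrow> 'k \<Rightarrow> 'k
    \<Rightarrow> 'n \<Rightarrow> ennreal" where
  "phi_vert M a \<beta> k x y j =
     (SUP z\<in>cell M j. \<Sum>\<^sub>\<infinity>e\<in>out_edges M j.
        (phi_edge M e (a powr (\<beta> * real k) * dist x y))\<^sup>2 / ennreal (wgt M e z))"

definition B_sum :: "('k::complete_space, 'e, 'n) markov_data \<Rightarrow> real \<Rightarrow> real \<Rightarrow> 'k \<Rightarrow> 'k \<Rightarrow> ennreal" where
  "B_sum M a \<beta> x y =
     (\<Sum>k. \<Sum>\<^sub>\<infinity>j\<in>Verts M.
        ell M j * (\<integral>\<^sup>+\<sigma>\<in>A_set M a \<beta> k x y. indicator (cell M j) (wcomp M \<sigma> k x) \<partial>path_measure M x)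
        + phi_vert M a \<beta> k x y j * emeasure ((U_adj M ^^ k) (return borel x)) (cell M j))"

text \<open>The vertex \<open>i\<close> is the one whose cell contains \<open>x\<close> and \<open>y\<close>.\<close>

definition ell_hat :: "('k::complete_space, 'e, 'n) markov_data \<Rightarrow> 'n \<Rightarrow> nat \<Rightarrow> ennreal" where
  "ell_hat M i k = Sup {ell M j | j. accessible M k i j}"

definition phi_hat :: "('k::complete_space, 'e, 'n) markov_data \<Rightarrow> real \<Rightarrow> real \<Rightarrow> 'n \<Rightarrow> nat \<Rightarrow> 'k \<Rightarrow> 'k
    \<Rightarrow> ennreal" where
  "phi_hat M a \<beta> i k x y = Sup {phi_vert M a \<beta> k x y j | j. accessible M k i j}"


section \<open>Well-definedness of the path measure\<close>

lemma topspace_Ebar: "topspace (Ebar_top M) = insert None (Some ` Edges M)"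
  by (simp add: Ebar_top_def)

lemma topspace_Sigma: "topspace (Sigma_top M) = {\<sigma>. \<forall>n. \<sigma> n \<in> topspace (Ebar_top M)}"
  by (auto simp: Sigma_top_def PiE_iff)

lemma Ebar_base:
  assumes "countable (Edges M)"
  obtains \<B> where "countable \<B>" "topspace (Ebar_top M) \<in> \<B>" "\<And>b. b \<in> \<B> \<Longrightarrow> b \<subseteq> topspace (Ebar_top M)"
    "\<And>V c. openin (Ebar_top M) V \<Longrightarrow> c \<in> V \<Longrightarrow> \<exists>b\<in>\<B>. c \<in> b \<and> b \<subseteq> V"
proof
  let ?B = "(\<lambda>e. {Some e}) ` Edges M
    \<union> (\<lambda>F. insert None (Some ` (Edges M - F))) ` {F. finite F \<and> F \<subseteq> Edges M}"
  have "countable {F. finite F \<and> F \<subseteq> Edges M}"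
    using countable_Collect_finite_subset[OF assms] by (simp add: conj_commute)
  then show "countable ?B" using assms by (intro countable_Un countable_image) auto
  show "topspace (Ebar_top M) \<in> ?B"
    unfolding topspace_Ebar by (intro UnI2 image_eqI[of _ _ "{}"]) auto
  show "b \<subseteq> topspace (Ebar_top M)" if "b \<in> ?B" for b
    using that by (auto simp: topspace_Ebar)
  fix V c assume V: "openin (Ebar_top M) V" "c \<in> V"
  show "\<exists>b\<in>?B. c \<in> b \<and> b \<subseteq> V"
  proof (cases c)
    case (Some e)
    then have "e \<in> Edges M" using V openin_subset[OF V(1)] by (auto simp: topspace_Ebar)
    then show ?thesis using Some V by (intro bexI[of _ "{Some e}"]) auto
  next
    case None
    then obtain C where "compactin (discrete_topology (Edges M)) C"
      "V = insert None (Some ` (Edges M - C))"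
      using V by (auto simp: Ebar_top_def openin_Alexandroff_compactification)
    then show ?thesis using None by (intro bexI[of _ V]) (auto simp: compactin_discrete_topology)
  qed
qed

lemma sets_borel_Sigma:
  assumes "countable (Edges M)"
  shows "sets (borel_of (Sigma_top M)) = sets (PiM UNIV (\<lambda>_. count_space (topspace (Ebar_top M))))"
    (is "_ = sets ?P")
proof -
  let ?\<Omega> = "topspace (Sigma_top M)" and ?E = "topspace (Ebar_top M)"
  have sp: "space ?P = ?\<Omega>" by (auto simp: space_PiM topspace_Sigma PiE_iff)
  have sub: "{U. openin (Sigma_top M) U} \<subseteq> Pow ?\<Omega>"
    using openin_subset by auto
  have setsB: "sets (borel_of (Sigma_top M)) = sigma_sets ?\<Omega> {U. openin (Sigma_top M) U}"
    unfolding borel_of_def by (rule sets_measure_of[OF sub])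
  have cntE: "countable ?E" using assms by (simp add: topspace_Ebar)
  have proj: "{\<sigma>\<in>?\<Omega>. \<sigma> n \<in> A} \<in> sets ?P" if "A \<subseteq> ?E" for n A
  proof -
    have "(\<lambda>\<sigma>. \<sigma> n) -` A \<inter> space ?P \<in> sets ?P"
      by (rule measurable_sets[OF measurable_component_singleton]) (use that in auto)
    also have "(\<lambda>\<sigma>. \<sigma> n) -` A \<inter> space ?P = {\<sigma>\<in>?\<Omega>. \<sigma> n \<in> A}" by (auto simp: sp)
    finally show ?thesis .
  qed
  obtain \<B> where B: "countable \<B>" "?E \<in> \<B>" "\<And>b. b \<in> \<B> \<Longrightarrow> b \<subseteq> ?E"
    "\<And>V c. openin (Ebar_top M) V \<Longrightarrow> c \<in> V \<Longrightarrow> \<exists>b\<in>\<B>. c \<in> b \<and> b \<subseteq> V"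
    using Ebar_base[OF assms] by metis
  define box where "box bs = {\<sigma>\<in>?\<Omega>. \<forall>m<length bs. \<sigma> m \<in> bs ! m}" for bs
  have box_meas: "box bs \<in> sets ?P" if "bs \<in> lists \<B>" for bs
  proof -
    have "box bs = ?\<Omega> \<inter> (\<Inter>m\<in>{..<length bs}. {\<sigma>\<in>?\<Omega>. \<sigma> m \<in> bs ! m})"
      by (auto simp: box_def)
    also have "\<dots> \<in> sets ?P"
    proof (cases "bs = []")
      case True
      then show ?thesis using sets.top[of ?P] by (simp add: sp)
    next
      case False
      have "(\<Inter>m\<in>{..<length bs}. {\<sigma>\<in>?\<Omega>. \<sigma> m \<in> bs ! m}) \<in> sets ?P"
      proof (rule sets.finite_INT)
        fix m assume "m \<in> {..<length bs}"
        then have "bs ! m \<in> \<B>" using that by (metis in_lists_conv_set lessThan_iff nth_mem)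
        from proj[OF B(3)[OF this]] show "{\<sigma>\<in>?\<Omega>. \<sigma> m \<in> bs ! m} \<in> sets ?P" .
      qed (use False in auto)
      then show ?thesis using sets.top[of ?P] unfolding sp by (rule sets.Int[rotated])
    qed
    finally show ?thesis .
  qed
  have open_meas: "U \<in> sets ?P" if U: "openin (Sigma_top M) U" for U
  proof -
    have ex: "\<exists>bs\<in>lists \<B>. \<sigma> \<in> box bs \<and> box bs \<subseteq> U" if s: "\<sigma> \<in> U" for \<sigma>
    proof -
      have s\<Omega>: "\<sigma> \<in> ?\<Omega>" using s U openin_subset by auto
      obtain V where V: "finite {i. V i \<noteq> ?E}" "\<And>i. openin (Ebar_top M) (V i)"
        "\<sigma> \<in> Pi\<^sub>E UNIV V" "Pi\<^sub>E UNIV V \<subseteq> U"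
        using U s unfolding Sigma_top_def openin_product_topology_alt by auto
      obtain N where N: "\<And>i. V i \<noteq> ?E \<Longrightarrow> i < N"
        using V(1) by (metis (mono_tags, lifting) finite_nat_set_iff_bounded mem_Collect_eq)
      have "\<forall>i. \<exists>b. b \<in> \<B> \<and> \<sigma> i \<in> b \<and> b \<subseteq> V i"
        using B(4)[OF V(2)] V(3) by (meson PiE_mem UNIV_I)
      then obtain b where b: "\<And>i. b i \<in> \<B> \<and> \<sigma> i \<in> b i \<and> b i \<subseteq> V i" by metis
      have "box (map b [0..<N]) \<subseteq> Pi\<^sub>E UNIV V"
      proof
        fix \<tau> assume t: "\<tau> \<in> box (map b [0..<N])"
        have "\<tau> i \<in> V i" for i
        proof (cases "i < N")
          case True then show ?thesis using t b[of i] by (auto simp: box_def)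
        next
          case False
          then have "V i = ?E" using N by auto
          then show ?thesis using t by (auto simp: box_def topspace_Sigma)
        qed
        then show "\<tau> \<in> Pi\<^sub>E UNIV V" by auto
      qed
      moreover have "\<sigma> \<in> box (map b [0..<N])" using b s\<Omega> by (auto simp: box_def)
      moreover have "map b [0..<N] \<in> lists \<B>" using b by auto
      ultimately show ?thesis using V(4) by blast
    qed
    have "U = (\<Union>bs\<in>{bs\<in>lists \<B>. box bs \<subseteq> U}. box bs)"
      using ex by blast
    also have "\<dots> \<in> sets ?P"
      by (rule sets.countable_UN'')
         (use box_meas in \<open>auto intro: countable_subset[OF _ countable_lists[OF B(1)]]\<close>)
    finally show ?thesis .
  qed
  have Some_meas: "{\<sigma>\<in>?\<Omega>. \<sigma> n \<in> Some ` A} \<in> sets (borel_of (Sigma_top M))" if "A \<subseteq> Edges M" for n A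
  proof -
    have "continuous_map (Sigma_top M) (Ebar_top M) (\<lambda>\<sigma>. \<sigma> n)"
      unfolding Sigma_top_def by (rule continuous_map_product_projection) simp
    moreover have "openin (Ebar_top M) (Some ` A)" using that by (simp add: Ebar_top_def)
    ultimately have "openin (Sigma_top M) {\<sigma>\<in>?\<Omega>. \<sigma> n \<in> Some ` A}"
      by (rule openin_continuous_map_preimage)
    then show ?thesis unfolding setsB by auto
  qed
  have spB: "space (borel_of (Sigma_top M)) = ?\<Omega>"
    unfolding borel_of_def by (rule space_measure_of[OF sub])
  show ?thesis
  proof (intro equalityI)
    show "sets (borel_of (Sigma_top M)) \<subseteq> sets ?P"
      using open_meas sets.top[of ?P] unfolding sp setsB by (intro sets.sigma_sets_subset') blast+
    show "sets ?P \<subseteq> sets (borel_of (Sigma_top M))"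
      unfolding sets_PiM_single spB[symmetric]
    proof (rule sets.sigma_sets_subset', safe)
      fix n A assume A: "A \<in> sets (count_space ?E)"
      have eq: "(\<Pi>\<^sub>E i\<in>UNIV. space (count_space ?E)) = ?\<Omega>"
        by (auto simp: topspace_Sigma PiE_iff)
      let ?A = "{e. Some e \<in> A}"
      have *: "?A \<subseteq> Edges M" using A by (auto simp: topspace_Ebar)
      have "{f \<in> \<Pi>\<^sub>E i\<in>UNIV. space (count_space ?E). f n \<in> A} =
        (if None \<in> A then ?\<Omega> - {\<sigma>\<in>?\<Omega>. \<sigma> n \<in> Some ` (Edges M - ?A)} else {\<sigma>\<in>?\<Omega>. \<sigma> n \<in> Some ` ?A})"
        (is "?L = ?R")
      proof (intro set_eqI)
        fix f
        show "f \<in> ?L \<longleftrightarrow> f \<in> ?R"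
        proof (cases "f \<in> ?\<Omega>")
          case True
          then have "f n \<in> insert None (Some ` Edges M)" by (simp add: topspace_Sigma topspace_Ebar)
          then show ?thesis unfolding eq using * True by (cases "f n") auto
        next
          case False
          then show ?thesis unfolding eq by auto
        qed
      qed
      also have "\<dots> \<in> sets (borel_of (Sigma_top M))"
        using Some_meas[OF *, of n] Some_meas[of "Edges M - ?A" n]
          sets.top[of "borel_of (Sigma_top M)"] unfolding spB by auto
      finally show "{f \<in> \<Pi>\<^sub>E i\<in>UNIV. space (count_space ?E). f n \<in> A} \<in> sets (borel_of (Sigma_top M))" .
    next
      show "(\<Pi>\<^sub>E i\<in>UNIV. space (count_space ?E)) \<in> sets (borel_of (Sigma_top M))"
      proof -
        have "(\<Pi>\<^sub>E i\<in>UNIV. space (count_space ?E)) = space (borel_of (Sigma_top M))"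
          by (auto simp: spB topspace_Sigma PiE_iff)
        then show ?thesis by simp
      qed
    qed
  qed
qed

lemma cylinder_in_PiM:
  "cylinder M cs \<in> sets (PiM UNIV (\<lambda>_. count_space (topspace (Ebar_top M))))"
proof -
  let ?P = "PiM (UNIV :: nat set) (\<lambda>_. count_space (topspace (Ebar_top M)))"
  have "cylinder M cs = {\<sigma> \<in> space ?P. \<forall>m\<in>{..<length cs}. \<sigma> m = cs ! m}"
    by (auto simp: cylinder_def space_PiM topspace_Sigma PiE_iff)
  also have "\<dots> \<in> sets ?P" by measurable
  finally show ?thesis .
qed

lemma wcomp_cong:
  assumes "\<And>m. m < k \<Longrightarrow> \<sigma> m = \<tau> m"
  shows "wcomp M \<sigma> k = wcomp M \<tau> k"
  using assms by (induction k) auto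

context Markov_system
begin

lemma pbar_nonneg: "c \<in> topspace (Ebar_top M) \<Longrightarrow> pbar M c x \<ge> 0"
  using wgt_range by (auto simp: pbar_def topspace_Ebar)

lemma nn_integral_pbar: "(\<integral>\<^sup>+c. ennreal (pbar M c x) \<partial>count_space (topspace (Ebar_top M))) = 1"
proof -
  have nn: "e \<in> Edges M \<Longrightarrow> wgt M e x \<ge> 0" for e using wgt_range by auto
  have "(\<integral>\<^sup>+c. ennreal (pbar M c x) \<partial>count_space (topspace (Ebar_top M)))
      = (\<integral>\<^sup>+c. ennreal (pbar M c x) \<partial>count_space (Some ` Edges M))"
    by (rule nn_integral_count_space_eq) (auto simp: topspace_Ebar pbar_def)
  also have "\<dots> = (\<integral>\<^sup>+e. ennreal (pbar M (Some e) x) \<partial>count_space (Edges M))"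
    by (rule nn_integral_bij_count_space[symmetric]) (auto simp: bij_betw_def)
  also have "\<dots> = (\<integral>\<^sup>+e. ennreal (wgt M e x) \<partial>count_space (Edges M))"
    by (simp add: pbar_def)
  also have "\<dots> = 1"
  proof -
    have "(\<lambda>e. wgt M e x) summable_on Edges M" using wgt_sum by (auto simp: has_sum_iff)
    then have "(\<lambda>e. norm (wgt M e x)) summable_on Edges M"
      using nn by (simp cong: summable_on_cong)
    then have "Infinite_Set_Sum.abs_summable_on (\<lambda>e. wgt M e x) (Edges M)"
      using abs_summable_equivalent by blast
    then have int: "integrable (count_space (Edges M)) (\<lambda>e. wgt M e x)"
      and "infsetsum (\<lambda>e. wgt M e x) (Edges M) = infsum (\<lambda>e. wgt M e x) (Edges M)"
      by (simp_all add: abs_summable_on_def infsetsum_infsum)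
    then have "(\<integral>e. wgt M e x \<partial>count_space (Edges M)) = 1"
      using wgt_sum[of x] by (simp add: infsetsum_def has_sum_iff)
    then show ?thesis using nn_integral_eq_integral[OF int] nn by (simp add: AE_count_space)
  qed
  finally show ?thesis .
qed

lemma ex_path_measure: "\<exists>P. is_path_measure M x P"
proof -
  let ?E = "topspace (Ebar_top M)"
  let ?C = "count_space ?E"
  define K where "K n \<omega> = density ?C (\<lambda>c. ennreal (pbar M c (wcomp M \<omega> n x)))" for n \<omega>
  have cntE: "countable ?E" using countable_Edges by (simp add: topspace_Ebar)
  have prob_K: "prob_space (K n \<omega>)" for n \<omega>
    by (rule prob_spaceI) (simp add: K_def emeasure_density nn_integral_pbar nn_integral_set_ennreal[symmetric] cong: nn_integral_cong_simp)
  have fin: "PiM {0..<n} (\<lambda>_. ?C) = count_space ({0..<n} \<rightarrow>\<^sub>E ?E)" for n :: nat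
    by (rule count_space_PiM_finite) (use cntE in auto)
  have K_sub: "K n \<omega> \<in> space (subprob_algebra ?C)" for n \<omega>
    using prob_space_imp_subprob_space[OF prob_K] by (auto simp: space_subprob_algebra K_def)
  interpret IT: Ionescu_Tulcea K "\<lambda>_. ?C"
  proof (rule Ionescu_Tulcea.intro)
    show "K n \<in> measurable (PiM {0..<n} (\<lambda>_. ?C)) (subprob_algebra ?C)" for n
      unfolding fin using K_sub by auto
  qed (rule prob_K)
  define r where "r \<sigma> n = restrict \<sigma> {0..<n}" for \<sigma> :: "nat \<Rightarrow> 'e option" and n :: nat
  have u: "(\<lambda>_. undefined) \<in> space (PiM {0..<0::nat} (\<lambda>_. ?C))" by (simp add: space_PiM)
  have C: "emeasure (IT.C 0 n (\<lambda>_. undefined)) {r \<sigma> n} = ennreal (\<Prod>m<n. pbar M (\<sigma> m) (wcomp M \<sigma> m x))"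
    if s: "\<And>m. m < n \<Longrightarrow> \<sigma> m \<in> ?E" for n \<sigma>
    using s
  proof (induction n)
    case 0
    then show ?case by (simp add: r_def restrict_def sets_PiM_empty)
  next
    case (Suc n)
    let ?u = "\<lambda>_. undefined" and ?p = "ennreal (pbar M (\<sigma> n) (wcomp M \<sigma> n x))"
    have rs: "r \<sigma> (Suc n) \<in> {0..<Suc n} \<rightarrow>\<^sub>E ?E" "r \<sigma> n \<in> {0..<n} \<rightarrow>\<^sub>E ?E"
      using Suc.prems by (auto simp: r_def)
    have spC: "space (IT.C 0 n ?u) = {0..<n} \<rightarrow>\<^sub>E ?E"
      using IT.space_C[OF u, of n] by (simp add: fin)
    have setsC: "sets (IT.C 0 n ?u) = Pow ({0..<n} \<rightarrow>\<^sub>E ?E)"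
      using IT.sets_C[OF u, of n] by (simp add: fin)
    have mC: "IT.eP n \<in> IT.C 0 n ?u \<rightarrow>\<^sub>M subprob_algebra (PiM {0..<Suc n} (\<lambda>_. ?C))"
    proof -
      have sC: "sets (IT.C 0 n ?u) = sets (PiM {0..<n} (\<lambda>_. ?C))"
        using IT.sets_C[OF u, of n] by (simp only: add_0)
      show ?thesis unfolding measurable_cong_sets[OF sC refl] by (rule IT.measurable_eP)
    qed
    have eP: "emeasure (IT.eP n \<omega>) {r \<sigma> (Suc n)} = ?p * indicator {r \<sigma> n} \<omega>"
      if w: "\<omega> \<in> {0..<n} \<rightarrow>\<^sub>E ?E" for \<omega>
    proof -
      have "emeasure (IT.eP n \<omega>) {r \<sigma> (Suc n)}
          = emeasure (K n \<omega>) ((\<lambda>c. fun_upd \<omega> n c) -` {r \<sigma> (Suc n)} \<inter> ?E)"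
        using IT.emeasure_eP[of \<omega> n "{r \<sigma> (Suc n)}"] w rs by (simp add: fin)
      also have "(\<lambda>c. fun_upd \<omega> n c) -` {r \<sigma> (Suc n)} \<inter> ?E = (if \<omega> = r \<sigma> n then {\<sigma> n} else {})"
      proof -
        have "fun_upd \<omega> n c = r \<sigma> (Suc n) \<longleftrightarrow> \<omega> = r \<sigma> n \<and> c = \<sigma> n" for c
        proof
          assume eq: "fun_upd \<omega> n c = r \<sigma> (Suc n)"
          have "c = \<sigma> n" using fun_cong[OF eq, of n] by (simp add: r_def)
          moreover have "\<omega> m = r \<sigma> n m" for m
            using fun_cong[OF eq, of m] w
            by (cases "m = n") (auto simp: r_def PiE_iff extensional_def)
          ultimately show "\<omega> = r \<sigma> n \<and> c = \<sigma> n" by auto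
        qed (auto simp: r_def restrict_def fun_eq_iff)
        then show ?thesis using Suc.prems[of n] by auto
      qed
      also have "emeasure (K n \<omega>) \<dots> = ?p * indicator {r \<sigma> n} \<omega>"
      proof (cases "\<omega> = r \<sigma> n")
        case True
        have "wcomp M \<omega> n x = wcomp M \<sigma> n x"
          unfolding True by (subst wcomp_cong[of n "r \<sigma> n" \<sigma>]) (auto simp: r_def)
        moreover have "emeasure (K n \<omega>) {\<sigma> n} = ennreal (pbar M (\<sigma> n) (wcomp M \<omega> n x))"
          using Suc.prems[of n] unfolding K_def
          by (simp add: emeasure_density nn_integral_indicator_singleton' one_ennreal_def[symmetric])
        ultimately show ?thesis using True by simp
      qed simp
      finally show ?thesis .
    qed
    have "emeasure (IT.C 0 (Suc n) ?u) {r \<sigma> (Suc n)}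
        = (\<integral>\<^sup>+\<omega>. emeasure (IT.eP n \<omega>) {r \<sigma> (Suc n)} \<partial>IT.C 0 n ?u)"
      using emeasure_bind[OF _ mC, of "{r \<sigma> (Suc n)}"] rs spC by (auto simp: fin)
    also have "\<dots> = (\<integral>\<^sup>+\<omega>. ?p * indicator {r \<sigma> n} \<omega> \<partial>IT.C 0 n ?u)"
      by (rule nn_integral_cong) (use eP spC in auto)
    also have "\<dots> = ?p * emeasure (IT.C 0 n ?u) {r \<sigma> n}"
      by (rule nn_integral_cmult_indicator) (use rs setsC in auto)
    also have "\<dots> = ?p * ennreal (\<Prod>m<n. pbar M (\<sigma> m) (wcomp M \<sigma> m x))"
      using Suc by simp
    also have "\<dots> = ennreal (\<Prod>m<Suc n. pbar M (\<sigma> m) (wcomp M \<sigma> m x))"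
      using Suc.prems by (subst ennreal_mult[symmetric]) (auto intro!: pbar_nonneg prod_nonneg simp: mult.commute)
    finally show ?case .
  qed
  have setsP: "sets IT.PF.lim = sets (borel_of (Sigma_top M))"
    using sets_borel_Sigma[OF countable_Edges] by simp
  have val: "emeasure IT.PF.lim (cylinder M cs) = ennreal (\<Prod>m<length cs. pbar M (cs ! m) (wcomp M ((!) cs) m x))"
    if cs: "set cs \<subseteq> ?E" for cs
  proof -
    define n where "n = length cs"
    let ?u = "\<lambda>_. undefined"
    have mem: "cs ! m \<in> ?E" if "m < n" for m using cs that by (auto simp: n_def)
    have ut: "IT.up_to {0..<n} = n"
      using IT.up_to_iff_Ico[of "{0..<n}" n] IT.up_to[of "{0..<n}"]
      by (auto simp: le_antisym subset_eq intro!: antisym)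
    have rin: "r ((!) cs) n \<in> {0..<n} \<rightarrow>\<^sub>E ?E" using mem by (auto simp: r_def)
    have "cylinder M cs = IT.PF.emb UNIV {0..<n} {r ((!) cs) n}"
      by (auto simp: cylinder_def prod_emb_def topspace_Sigma PiE_iff r_def n_def restrict_def fun_eq_iff)
         metis
    then have "emeasure IT.PF.lim (cylinder M cs) = emeasure (IT.CI {0..<n}) {r ((!) cs) n}"
      using IT.lim[of "{0..<n}" "{r ((!) cs) n}"] rin by (simp add: fin)
    also have "\<dots> = emeasure (IT.C 0 n ?u) {r ((!) cs) n}"
    proof -
      have sC: "sets (IT.C 0 n ?u) = sets (PiM {0..<n} (\<lambda>_. ?C))"
        using IT.sets_C[OF u, of n] by simp
      have "distr (IT.C 0 n ?u) (PiM {0..<n} (\<lambda>_. ?C)) (\<lambda>f. restrict f {0..<n})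
          = distr (IT.C 0 n ?u) (IT.C 0 n ?u) (\<lambda>f. f)"
        by (rule distr_cong) (use IT.space_C[OF u, of n] sC in \<open>auto simp: space_PiM\<close>)
      also have "\<dots> = IT.C 0 n ?u" by (rule distr_id)
      finally show ?thesis by (simp add: IT.CI_def ut)
    qed
    also have "\<dots> = ennreal (\<Prod>m<n. pbar M (cs ! m) (wcomp M ((!) cs) m x))"
      by (rule C) (rule mem)
    finally show ?thesis by (simp add: n_def)
  qed
  have "prob_space IT.PF.lim"
  proof (rule prob_spaceI)
    have "space IT.PF.lim = cylinder M []"
      using sets_eq_imp_space_eq[OF IT.PF.sets_lim]
      by (auto simp: space_PiM cylinder_def topspace_Sigma PiE_iff)
    then show "emeasure IT.PF.lim (space IT.PF.lim) = 1" using val[of "[]"] by simp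
  qed
  then have "is_path_measure M x IT.PF.lim" using setsP val by (simp add: is_path_measure_def)
  then show ?thesis ..
qed

lemma path_measure_unique:
  assumes P: "is_path_measure M x P" and Q: "is_path_measure M x Q"
  shows "P = Q"
proof -
  let ?E = "topspace (Ebar_top M)" and ?\<Omega> = "topspace (Sigma_top M)"
  let ?P = "PiM (UNIV :: nat set) (\<lambda>_. count_space ?E)"
  let ?G = "insert {} (cylinder M ` {cs. set cs \<subseteq> ?E})"
  have cntE: "countable ?E" using countable_Edges by (simp add: topspace_Ebar)
  have sp: "space ?P = ?\<Omega>" by (auto simp: space_PiM topspace_Sigma PiE_iff)
  have GP: "?G \<subseteq> Pow ?\<Omega>" by (auto simp: cylinder_def)
  have Int: "cylinder M as \<inter> cylinder M bs \<in> ?G"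
    if "set as \<subseteq> ?E" "set bs \<subseteq> ?E" "length as \<le> length bs" for as bs
  proof (cases "\<forall>m<length as. as ! m = bs ! m")
    case True
    then have "cylinder M as \<inter> cylinder M bs = cylinder M bs"
      using that by (auto simp: cylinder_def)
    then show ?thesis using that by auto
  next
    case False
    then have "cylinder M as \<inter> cylinder M bs = {}"
      using that by (auto simp: cylinder_def dest: order_less_le_trans)
    then show ?thesis by auto
  qed
  have stable: "Int_stable ?G"
  proof (rule Int_stableI)
    fix A B assume "A \<in> ?G" "B \<in> ?G"
    then consider "A = {} \<or> B = {}"
      | as bs where "A = cylinder M as" "B = cylinder M bs" "set as \<subseteq> ?E" "set bs \<subseteq> ?E" by blast
    then show "A \<inter> B \<in> ?G"
    proof cases
      case 2
      then show ?thesis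
        using Int[of as bs] Int[of bs as] by (cases "length as \<le> length bs") (auto simp: Int_commute)
    qed auto
  qed
  have gen: "sets ?P = sigma_sets ?\<Omega> ?G"
  proof (rule equalityI)
    interpret G: sigma_algebra ?\<Omega> "sigma_sets ?\<Omega> ?G" by (rule sigma_algebra_sigma_sets[OF GP])
    show "sigma_sets ?\<Omega> ?G \<subseteq> sets ?P"
      using cylinder_in_PiM[of M] sets.top[of ?P] unfolding sp by (intro sets.sigma_sets_subset') blast+
    show "sets ?P \<subseteq> sigma_sets ?\<Omega> ?G"
      unfolding sets_PiM_single
    proof -
      have eq: "(\<Pi>\<^sub>E i\<in>UNIV. space (count_space ?E)) = ?\<Omega>"
        by (auto simp: topspace_Sigma PiE_iff)
      show "sigma_sets (\<Pi>\<^sub>E i\<in>UNIV. space (count_space ?E))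
          {{f \<in> \<Pi>\<^sub>E i\<in>UNIV. space (count_space ?E). f i \<in> A} |i A. i \<in> UNIV \<and> A \<in> sets (count_space ?E)}
          \<subseteq> sigma_sets ?\<Omega> ?G"
        unfolding eq
      proof (rule G.sigma_sets_subset, safe)
        fix n :: nat and A assume A: "A \<in> sets (count_space ?E)"
        let ?L = "{cs. set cs \<subseteq> ?E \<and> length cs = Suc n \<and> cs ! n \<in> A}"
        have "{f \<in> ?\<Omega>. f n \<in> A} = (\<Union>cs\<in>?L. cylinder M cs)"
        proof (intro equalityI subsetI)
          fix f assume f: "f \<in> {f \<in> ?\<Omega>. f n \<in> A}"
          have "map f [0..<Suc n] \<in> ?L" using f
            by (auto simp: topspace_Sigma nth_append)
          moreover have "f \<in> cylinder M (map f [0..<Suc n])"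
            using f by (auto simp: cylinder_def simp del: upt_Suc)
          ultimately show "f \<in> (\<Union>cs\<in>?L. cylinder M cs)" by blast
        qed (auto simp: cylinder_def)
        also have "\<dots> \<in> sigma_sets ?\<Omega> ?G"
        proof (rule G.countable_UN'')
          have "countable (lists ?E)" by (rule countable_lists[OF cntE])
          then show "countable ?L" by (rule countable_subset[rotated]) auto
        qed (auto intro: sigma_sets.Basic)
        finally show "{f \<in> ?\<Omega>. f n \<in> A} \<in> sigma_sets ?\<Omega> ?G" .
      qed
    qed
  qed
  show ?thesis
  proof (rule measure_eqI_generator_eq[OF stable GP, where A="\<lambda>_. ?\<Omega>"])
    show "X \<in> ?G \<Longrightarrow> emeasure P X = emeasure Q X" for X
      using P Q by (auto simp: is_path_measure_def)
    show "sets P = sigma_sets ?\<Omega> ?G" "sets Q = sigma_sets ?\<Omega> ?G"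
      using P Q gen sets_borel_Sigma[OF countable_Edges] by (auto simp: is_path_measure_def)
    have "?\<Omega> = cylinder M []" by (auto simp: cylinder_def)
    then show "range (\<lambda>_. ?\<Omega>) \<subseteq> ?G" by auto
    have "finite_measure P" using P prob_space.finite_measure by (auto simp: is_path_measure_def)
    then show "emeasure P ?\<Omega> \<noteq> \<infinity>" by (simp add: finite_measure.emeasure_finite)
  qed auto
qed

lemma path_measure: "is_path_measure M x (path_measure M x)"
proof -
  obtain P where P: "is_path_measure M x P" using ex_path_measure by blast
  show ?thesis unfolding path_measure_def
    by (rule theI[of _ P]) (auto intro: P path_measure_unique)
qed

end

end

theory Submission
  imports Defs
begin

text \<open>All quantities at time \<open>k\<close> become countable sums over edge lists \<open>es\<close> of length \<open>k\<close>, weighted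
  by the probability that the process from \<open>x\<close> follows \<open>es\<close>. Iterating contractivity gives
  \<open>\<Sum>\<^sub>e\<^sub>s p\<^sub>e\<^sub>s(x) d(w\<^sub>e\<^sub>s x, w\<^sub>e\<^sub>s y) \<le> a\<^sup>k d(x, y)\<close>, so by Markov's inequality \<open>A\<^sub>x\<^sub>y\<close> at time \<open>k\<close> has
  probability at most \<open>a powr ((1 - \<beta>) k)\<close>; it is null if every map contracts by \<open>a\<close>. The masses of
  the cells at time \<open>k\<close> sum to at most \<open>1\<close> and vanish on vertices that are not accessible by a path
  of length \<open>k\<close>, so the sum over vertices is at most the supremum of its coefficients over the
  accessible ones times the total mass.\<close>

section \<open>Countable sums as integrals over counting measures\<close>

text \<open>Turns the unordered sums of the definitions into integrals, where monotonicity, scaling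
  and Tonelli's theorem are at hand. An infinite countable \<open>A\<close> is enumerated, and both
  sides become the same series.\<close>

lemma infsum_eq_nn_integral_count_space:
  fixes f :: "'a \<Rightarrow> ennreal"
  assumes "countable A"
  shows "infsum f A = (\<integral>\<^sup>+x. f x \<partial>count_space A)"
proof (cases "finite A")
  case True
  then show ?thesis by (simp add: nn_integral_count_space_finite)
next
  case False
  let ?g = "from_nat_into A"
  have g: "bij_betw ?g UNIV A" using assms False by (rule bij_betw_from_nat_into)
  have "infsum f A = infsum (\<lambda>n. f (?g n)) UNIV"
    using infsum_reindex_bij_betw[OF g, of f] by simp
  also have "\<dots> = (\<Sum>n. f (?g n))"
    by (rule sums_unique, rule has_sum_imp_sums, rule has_sum_infsum, rule nonneg_summable_on_complete) simp
  also have "\<dots> = (\<integral>\<^sup>+x. f x \<partial>count_space A)"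
    by (simp add: nn_integral_count_space_nat[symmetric] nn_integral_bij_count_space[OF g])
  finally show ?thesis .
qed

text \<open>The common source of the suprema \<open>ell_hat\<close> and \<open>phi_hat\<close>:
  \<open>P\<close> will be accessibility at time \<open>k\<close>, \<open>c\<close> the coefficient
  of a vertex and \<open>f\<close> its mass. Terms outside \<open>P\<close> vanish, so every
  coefficient may be replaced by the supremum over \<open>P\<close>.\<close>

lemma nn_integral_count_space_weighted_le:
  fixes c f :: "'a \<Rightarrow> ennreal"
  assumes "\<And>j. j \<in> V \<Longrightarrow> \<not> P j \<Longrightarrow> f j = 0"
    and "(\<integral>\<^sup>+j. f j \<partial>count_space V) \<le> b"
  shows "(\<integral>\<^sup>+j. c j * f j \<partial>count_space V) \<le> Sup {c j | j. P j} * b"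
proof -
  have "(\<integral>\<^sup>+j. c j * f j \<partial>count_space V)
      \<le> (\<integral>\<^sup>+j. Sup {c j | j. P j} * f j \<partial>count_space V)"
  proof (rule nn_integral_mono)
    fix j assume "j \<in> space (count_space V)"
    then show "c j * f j \<le> Sup {c j | j. P j} * f j"
      using assms(1)[of j] by (cases "P j") (auto intro!: mult_right_mono Sup_upper)
  qed
  also have "\<dots> = Sup {c j | j. P j} * (\<integral>\<^sup>+j. f j \<partial>count_space V)"
    by (rule nn_integral_cmult) simp
  also have "\<dots> \<le> Sup {c j | j. P j} * b" using assms(2) by (rule mult_left_mono) simp
  finally show ?thesis .
qed

section \<open>Finite edge lists: weights, composed maps, cylinders\<close>

text \<open>The recursion peels off the first edge and moves the starting point, the form in which
  contractivity is iterated; \<open>wcomp\<close> instead grows at the last letter.\<close>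

primrec path_weight :: "('k, 'e, 'n) markov_data \<Rightarrow> 'e list \<Rightarrow> 'k \<Rightarrow> real" where
  "path_weight M [] x = 1"
| "path_weight M (e # es) x = wgt M e x * path_weight M es (wmap M e x)"

primrec path_map :: "('k, 'e, 'n) markov_data \<Rightarrow> 'e list \<Rightarrow> 'k \<Rightarrow> 'k" where
  "path_map M [] x = x"
| "path_map M (e # es) x = path_map M es (wmap M e x)"

text \<open>Consecutive edges need not match. In a Markov system a list that does not match has
  weight 0 at every point, because a positive weight forces each edge to start in the cell reached
  by the previous one.\<close>

definition edge_lists :: "('k, 'e, 'n) markov_data \<Rightarrow> nat \<Rightarrow> 'e list set" where
  "edge_lists M k = {es. set es \<subseteq> Edges M \<and> length es = k}"

text \<open>Bridges the two recursions: the composition grows at the end with \<open>m\<close>,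
  while the head \<open>c\<close> is absorbed into the point.\<close>

lemma wcomp_Cons: "wcomp M ((!) (c # cs)) (Suc m) x = wcomp M ((!) cs) m (wbar M c x)"
  by (induction m) auto

lemma wcomp_map_Some: "wcomp M ((!) (map Some es)) (length es) x = path_map M es x"
proof (induction es arbitrary: x)
  case (Cons e es)
  show ?case using wcomp_Cons[of M "Some e" "map Some es" "length es" x] Cons
    by (simp add: wbar_def)
qed simp

text \<open>Splitting off the first factor turns the product that defines cylinder probabilities
  into the recursion of \<open>path_weight\<close>.\<close>

lemma prod_pbar_map_Some:
  "(\<Prod>m<length es. pbar M (map Some es ! m) (wcomp M ((!) (map Some es)) m x)) = path_weight M es x"
proof (induction es arbitrary: x)
  case (Cons e es)
  show ?case unfolding list.map list.size add_0_right add_Suc_right prod.lessThan_Suc_shift wcomp_Cons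
    by (simp add: Cons wbar_def pbar_def[of M "Some e"] del: nth_map)
qed simp

lemma wcomp_cylinder:
  assumes "\<sigma> \<in> cylinder M (map Some es)"
  shows "wcomp M \<sigma> (length es) x = path_map M es x"
proof -
  have "wcomp M \<sigma> (length es) = wcomp M ((!) (map Some es)) (length es)"
    using assms by (intro wcomp_cong) (auto simp: cylinder_def)
  then show ?thesis by (simp add: wcomp_map_Some)
qed

text \<open>A sequence in \<open>Sigma_G\<close> avoids the point at infinity, so its first
  \<open>k\<close> letters form an edge list.\<close>

lemma ex_edge_list_cylinder:
  assumes "\<sigma> \<in> Sigma_G M"
  shows "\<exists>es\<in>edge_lists M k. \<sigma> \<in> cylinder M (map Some es)"
proof -
  obtain s where s: "\<And>n. \<sigma> n = Some (s n)" "\<And>n. s n \<in> Edges M"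
    using assms by (auto simp: Sigma_G_def)
  then show ?thesis
    by (intro bexI[of _ "map s [0..<k]"])
       (auto simp: edge_lists_def cylinder_def topspace_Sigma topspace_Ebar)
qed

section \<open>Paths and accessibility\<close>

lemma is_path_Cons:
  "is_path M (e # es) \<longleftrightarrow> e \<in> Edges M \<and> (es = [] \<or> is_path M es \<and> ini M (hd es) = ter M e)"
proof (cases es)
  case (Cons f fs)
  have "(\<forall>m. Suc m < length (e # es) \<longrightarrow> ini M ((e # es) ! Suc m) = ter M ((e # es) ! m))
      \<longleftrightarrow> ini M f = ter M e \<and> (\<forall>m. Suc m < length es \<longrightarrow> ini M (es ! Suc m) = ter M (es ! m))"
    using less_Suc_eq_0_disj by (auto simp: Cons nth_Cons split: nat.splits)
  then show ?thesis by (auto simp: is_path_def Cons)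
qed (simp add: is_path_def)

text \<open>Appending an edge fits the iteration of \<open>U_adj\<close>, whose newest step is the
  last one.\<close>

lemma accessible_Suc:
  assumes "accessible M k i j" "e \<in> Edges M" "ini M e = j"
  shows "accessible M (Suc k) i (ter M e)"
proof (cases "k = 0")
  case True
  then show ?thesis using assms
    by (auto simp: accessible_def is_path_def intro!: exI[of _ "[e]"])
next
  case False
  then obtain es where es: "is_path M es" "length es = k" "ini M (hd es) = i" "ter M (last es) = j"
    using assms by (auto simp: accessible_def)
  have "is_path M (es @ [e])"
    using es assms
    by (auto simp: is_path_def nth_append last_conv_nth not_less less_Suc_eq) (metis One_nat_def diff_Suc_1)
  moreover have "hd (es @ [e]) = hd es" using es by (simp add: is_path_def)
  ultimately show ?thesis using es by (auto simp: accessible_def intro!: exI[of _ "es @ [e]"])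
qed

text \<open>Prepending an edge fits the recursion of \<open>path_weight\<close>.\<close>

lemma accessible_Suc_left:
  assumes "e \<in> Edges M" "accessible M k (ter M e) j"
  shows "accessible M (Suc k) (ini M e) j"
proof (cases "k = 0")
  case True
  then show ?thesis using assms
    by (auto simp: accessible_def is_path_def intro!: exI[of _ "[e]"])
next
  case False
  then obtain es where "is_path M es" "length es = k" "ini M (hd es) = ter M e" "ter M (last es) = j"
    using assms by (auto simp: accessible_def)
  then show ?thesis using assms False
    by (auto simp: accessible_def is_path_Cons intro!: exI[of _ "e # es"])
qed

section \<open>The adjoint operator on measures\<close>

lemma sets_U_adj [simp]: "sets (U_adj M \<nu>) = sets borel"
  and space_U_adj [simp]: "space (U_adj M \<nu>) = UNIV"
  using sets.sigma_sets_eq[of borel]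
  by (simp_all add: U_adj_def sets_measure_of_conv space_measure_of_conv)

text \<open>Only an inequality is claimed because \<^const>\<open>measure_of\<close> is zero on a set function that
  is not a measure.\<close>

lemma emeasure_U_adj_le: "emeasure (U_adj M \<nu>) A \<le> (\<integral>\<^sup>+x. U_op M (indicator A) x \<partial>\<nu>)"
  by (simp add: U_adj_def emeasure_measure_of_conv)

lemma sets_U_adj_funpow: "sets ((U_adj M ^^ k) (return borel x)) = sets borel"
  by (cases k) auto

section \<open>Elementary facts on cells and weights\<close>

context Markov_system
begin

lemma wgt_nonneg: "e \<in> Edges M \<Longrightarrow> wgt M e x \<ge> 0"
  using wgt_range by auto

lemma wgt_neq_0D: "e \<in> Edges M \<Longrightarrow> wgt M e x \<noteq> 0 \<Longrightarrow> x \<in> cell M (ini M e)"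
  using wgt_support[of e] wgt_nonneg[of e x] by auto

lemma wmap_in_cell: "e \<in> Edges M \<Longrightarrow> x \<in> cell M (ini M e) \<Longrightarrow> wmap M e x \<in> cell M (ter M e)"
  using wmap_cell by blast

lemma ini_in_Verts: "e \<in> Edges M \<Longrightarrow> ini M e \<in> Verts M"
  and ter_in_Verts: "e \<in> Edges M \<Longrightarrow> ter M e \<in> Verts M"
  using ini_surj ter_range by blast+

lemma cell_unique:
  "i \<in> Verts M \<Longrightarrow> j \<in> Verts M \<Longrightarrow> x \<in> cell M i \<Longrightarrow> x \<in> cell M j \<Longrightarrow> i = j"
  using cell_disjoint by (auto simp: disjoint_family_on_def)

lemma countable_Verts: "countable (Verts M)"
  using countable_Edges ini_surj by (metis countable_image)

lemma countable_edge_lists: "countable (edge_lists M k)"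
  by (rule countable_subset[OF _ countable_lists[OF countable_Edges]]) (auto simp: edge_lists_def)

text \<open>The sum is 1 over the reals; finite partial sums agree in \<open>ennreal\<close>, hence
  so does their supremum.\<close>

lemma infsum_wgt: "(\<Sum>\<^sub>\<infinity>e\<in>Edges M. ennreal (wgt M e x)) = 1"
proof -
  have s: "(\<lambda>e. wgt M e x) summable_on Edges M" "infsum (\<lambda>e. wgt M e x) (Edges M) = 1"
    using wgt_sum[of x] by (auto simp: has_sum_iff)
  have "(\<Sum>\<^sub>\<infinity>e\<in>Edges M. ennreal (wgt M e x))
      = (SUP F\<in>{F. finite F \<and> F \<subseteq> Edges M}. \<Sum>e\<in>F. ennreal (wgt M e x))"
    by (rule nonneg_infsum_complete) simp
  also have "\<dots> = (SUP F\<in>{F. finite F \<and> F \<subseteq> Edges M}. ennreal (\<Sum>e\<in>F. wgt M e x))"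
    by (intro SUP_cong refl sum_ennreal) (use wgt_nonneg in auto)
  also have "\<dots> = 1"
    using infsum_nonneg_is_SUPREMUM_ennreal[OF s(1) wgt_nonneg] s(2) by simp
  finally show ?thesis .
qed

section \<open>Sums over edge lists and iterated contractivity\<close>

lemma path_weight_nonneg: "es \<in> edge_lists M k \<Longrightarrow> path_weight M es x \<ge> 0"
  by (induction es arbitrary: x k) (auto simp: edge_lists_def wgt_nonneg)

lemma nn_integral_edge_lists_0:
  "(\<integral>\<^sup>+es. f es \<partial>count_space (edge_lists M 0)) = f []"
proof -
  have "edge_lists M 0 = {[]}" by (auto simp: edge_lists_def)
  then show ?thesis by (simp add: nn_integral_count_space_finite)
qed

text \<open>A nonempty list is a pair of head and tail, and over countable sets a product of
  counting measures is a counting measure. Tonelli's theorem then gives the first-step decomposition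
  used in the inductions.\<close>

lemma nn_integral_edge_lists_Suc:
  "(\<integral>\<^sup>+es. f es \<partial>count_space (edge_lists M (Suc k)))
     = (\<integral>\<^sup>+e. \<integral>\<^sup>+es. f (e # es) \<partial>count_space (edge_lists M k) \<partial>count_space (Edges M))"
proof -
  interpret L: sigma_finite_measure "count_space (edge_lists M k)"
    by (rule sigma_finite_measure_count_space_countable[OF countable_edge_lists])
  have pr: "count_space (Edges M) \<Otimes>\<^sub>M count_space (edge_lists M k)
      = count_space (Edges M \<times> edge_lists M k)"
    by (rule pair_measure_countable[OF countable_Edges countable_edge_lists])
  have bij: "bij_betw (\<lambda>(e, es). e # es) (Edges M \<times> edge_lists M k) (edge_lists M (Suc k))"
    unfolding bij_betw_def by (auto simp: inj_on_def edge_lists_def image_iff length_Suc_conv)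
  show ?thesis
    using L.nn_integral_fst[of "\<lambda>(e, es). f (e # es)" "count_space (Edges M)"]
      nn_integral_bij_count_space[OF bij, of f]
    by (simp add: pr case_prod_unfold)
qed

lemma nn_integral_path_weight_le:
  "(\<integral>\<^sup>+es. ennreal (path_weight M es x) \<partial>count_space (edge_lists M k)) \<le> 1"
proof (induction k arbitrary: x)
  case (Suc k)
  have "(\<integral>\<^sup>+es. ennreal (path_weight M es x) \<partial>count_space (edge_lists M (Suc k)))
      = (\<integral>\<^sup>+e. ennreal (wgt M e x)
          * (\<integral>\<^sup>+es. ennreal (path_weight M es (wmap M e x)) \<partial>count_space (edge_lists M k))
          \<partial>count_space (Edges M))"
    unfolding nn_integral_edge_lists_Suc
    by (intro nn_integral_cong, subst nn_integral_cmult[symmetric])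
       (auto intro!: nn_integral_cong simp: ennreal_mult wgt_nonneg path_weight_nonneg)
  also have "\<dots> \<le> (\<integral>\<^sup>+e. ennreal (wgt M e x) * 1 \<partial>count_space (Edges M))"
    by (intro nn_integral_mono mult_left_mono Suc) auto
  also have "\<dots> = 1"
    using infsum_wgt[of x] by (simp add: infsum_eq_nn_integral_count_space[OF countable_Edges])
  finally show ?case .
qed (simp add: nn_integral_edge_lists_0)

text \<open>After a first edge \<open>e\<close> of positive weight both points lie in
  \<open>cell M (ter M e)\<close>, so the induction hypothesis bounds the rest by
  \<open>a ^ k\<close> times the new distance. Contractivity bounds the weighted sum of the new
  distances by \<open>a * dist x y\<close>.\<close>

lemma nn_integral_path_weight_dist_le:
  assumes "contractive_system M a" "i \<in> Verts M" "x \<in> cell M i" "y \<in> cell M i"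
  shows "(\<integral>\<^sup>+es. ennreal (path_weight M es x * dist (path_map M es x) (path_map M es y))
            \<partial>count_space (edge_lists M k)) \<le> ennreal (a ^ k * dist x y)"
  using assms(2-)
proof (induction k arbitrary: i x y)
  case 0
  then show ?case by (simp add: nn_integral_edge_lists_0)
next
  case (Suc k)
  have a: "0 \<le> a" using assms(1) by (simp add: contractive_system_def)
  let ?O = "out_edges M i"
  have O: "countable ?O" "?O \<subseteq> Edges M"
    using countable_Edges by (auto simp: out_edges_def intro: countable_subset)
  let ?d = "\<lambda>e. dist (wmap M e x) (wmap M e y)"
  have "(\<integral>\<^sup>+es. ennreal (path_weight M es x * dist (path_map M es x) (path_map M es y))
            \<partial>count_space (edge_lists M (Suc k)))
      = (\<integral>\<^sup>+e. ennreal (wgt M e x) * (\<integral>\<^sup>+es. ennreal (path_weight M es (wmap M e x)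
            * dist (path_map M es (wmap M e x)) (path_map M es (wmap M e y)))
            \<partial>count_space (edge_lists M k)) \<partial>count_space (Edges M))"
    unfolding nn_integral_edge_lists_Suc
    by (intro nn_integral_cong, subst nn_integral_cmult[symmetric])
       (auto intro!: nn_integral_cong simp: ennreal_mult[symmetric] wgt_nonneg path_weight_nonneg mult.assoc)
  also have "\<dots> \<le> (\<integral>\<^sup>+e. ennreal (a ^ k) * (ennreal (wgt M e x) * ennreal (?d e)) \<partial>count_space (Edges M))"
  proof (rule nn_integral_mono)
    fix e assume "e \<in> space (count_space (Edges M))"
    then have e: "e \<in> Edges M" by simp
    show "ennreal (wgt M e x) * (\<integral>\<^sup>+es. ennreal (path_weight M es (wmap M e x)
            * dist (path_map M es (wmap M e x)) (path_map M es (wmap M e y)))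
            \<partial>count_space (edge_lists M k)) \<le> ennreal (a ^ k) * (ennreal (wgt M e x) * ennreal (?d e))"
    \<comment> \<open>Positive weight at \<open>x\<close> means that \<open>e\<close> leaves
      \<open>i\<close>, so \<open>e\<close> maps \<open>x\<close> and \<open>y\<close> into one
      cell; with weight 0 both sides vanish.\<close>
    proof (cases "wgt M e x = 0")
      case False
      then have "ini M e = i"
        using wgt_neq_0D[OF e] cell_unique[OF ini_in_Verts[OF e]] Suc.prems by blast
      then have "wmap M e x \<in> cell M (ter M e)" "wmap M e y \<in> cell M (ter M e)"
        using Suc.prems wmap_in_cell[OF e] by auto
      from mult_left_mono[OF Suc.IH[OF ter_in_Verts[OF e] this], of "ennreal (wgt M e x)"]
      show ?thesis using a by (simp add: ennreal_mult mult_ac)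
    qed simp
  qed
  also have "\<dots> = ennreal (a ^ k) * (\<integral>\<^sup>+e. ennreal (wgt M e x) * ennreal (?d e) \<partial>count_space (Edges M))"
    by (rule nn_integral_cmult) simp
  \<comment> \<open>Contractivity sums only over the edges leaving \<open>i\<close>; all others have
    weight 0 at \<open>x\<close>.\<close>
  also have "(\<integral>\<^sup>+e. ennreal (wgt M e x) * ennreal (?d e) \<partial>count_space (Edges M))
      = (\<integral>\<^sup>+e. ennreal (wgt M e x) * ennreal (?d e) \<partial>count_space ?O)"
  proof (rule nn_integral_count_space_eq)
    fix e assume e: "e \<in> Edges M - ?O"
    then have "wgt M e x = 0"
      using wgt_neq_0D[of e x] cell_unique[OF ini_in_Verts[of e]] Suc.prems
      by (auto simp: out_edges_def)
    then show "ennreal (wgt M e x) * ennreal (?d e) = 0" by simp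
  qed (use O in auto)
  also have "\<dots> \<le> ennreal (a * dist x y)"
    using assms(1) Suc.prems
    by (auto simp: contractive_system_def infsum_eq_nn_integral_count_space[OF O(1)])
  also have "ennreal (a ^ k) * ennreal (a * dist x y) = ennreal (a ^ Suc k * dist x y)"
    using a by (simp add: ennreal_mult mult_ac)
  finally show ?case by (simp add: mult_left_mono)
qed

text \<open>Each edge of a list of nonzero weight starts in the cell of the current point. Hence the
  list is a path from \<open>i\<close>, and the end point lies in the cell of its terminal
  vertex.\<close>

lemma path_weight_neq_0D:
  assumes "path_weight M es x \<noteq> 0" "es \<in> edge_lists M k" "i \<in> Verts M" "x \<in> cell M i"
  shows "\<exists>j\<in>Verts M. accessible M k i j \<and> path_map M es x \<in> cell M j"
  using assms
proof (induction es arbitrary: x i k)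
  case Nil
  then show ?case by (auto simp: edge_lists_def accessible_def)
next
  case (Cons e es)
  then obtain k' where k: "k = Suc k'" and e: "e \<in> Edges M" and es: "es \<in> edge_lists M k'"
    by (auto simp: edge_lists_def)
  have xe: "x \<in> cell M (ini M e)" using Cons.prems wgt_neq_0D[OF e] by auto
  then have i: "i = ini M e" using cell_unique Cons.prems ini_in_Verts[OF e] by blast
  show ?case
    using Cons.IH[OF _ es ter_in_Verts[OF e] wmap_in_cell[OF e xe]] Cons.prems
      accessible_Suc_left[OF e] by (auto simp: k i)
qed

text \<open>Nonzero weight keeps the orbit of \<open>x\<close> in the cells that the edges leave;
  the orbit of \<open>y\<close> shares these cells because edges map cells into cells. So the
  contraction applies at every step.\<close>

lemma dist_path_map_le:
  assumes contr: "\<forall>e\<in>Edges M. \<forall>u\<in>cell M (ini M e). \<forall>v\<in>cell M (ini M e).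
              dist (wmap M e u) (wmap M e v) \<le> a * dist u v" and a: "0 \<le> a"
    and "path_weight M es x \<noteq> 0" "es \<in> edge_lists M k" "i \<in> Verts M" "x \<in> cell M i" "y \<in> cell M i"
  shows "dist (path_map M es x) (path_map M es y) \<le> a ^ k * dist x y"
  using assms(3-)
proof (induction es arbitrary: x y i k)
  case Nil
  then show ?case by (auto simp: edge_lists_def)
next
  case (Cons e es)
  then obtain k' where k: "k = Suc k'" and e: "e \<in> Edges M" and es: "es \<in> edge_lists M k'"
    by (auto simp: edge_lists_def)
  have xe: "x \<in> cell M (ini M e)" using Cons.prems wgt_neq_0D[OF e] by auto
  then have ye: "y \<in> cell M (ini M e)" using cell_unique[OF _ ini_in_Verts[OF e]] Cons.prems by blast
  have "dist (path_map M (e # es) x) (path_map M (e # es) y) \<le> a ^ k' * dist (wmap M e x) (wmap M e y)"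
    using Cons.IH[OF _ es ter_in_Verts[OF e] wmap_in_cell[OF e xe] wmap_in_cell[OF e ye]] Cons.prems by auto
  also have "\<dots> \<le> a ^ k' * (a * dist x y)"
    using contr e xe ye a by (intro mult_left_mono) auto
  finally show ?case by (simp add: k mult_ac)
qed

section \<open>From the path measure to edge lists\<close>

lemma emeasure_path_measure_cylinder:
  assumes "es \<in> edge_lists M k"
  shows "emeasure (path_measure M x) (cylinder M (map Some es)) = ennreal (path_weight M es x)"
proof -
  have "set (map Some es) \<subseteq> topspace (Ebar_top M)"
    using assms by (auto simp: edge_lists_def topspace_Ebar)
  then show ?thesis
    using path_measure[of x] prod_pbar_map_Some[of M es x] by (auto simp: is_path_measure_def)
qed

lemma cylinder_sets: "cylinder M cs \<in> sets (path_measure M x)"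
  using path_measure[of x] cylinder_in_PiM[of M cs] sets_borel_Sigma[OF countable_Edges]
  by (simp add: is_path_measure_def)

text \<open>Monotonicity of the integral holds for arbitrary integrands, so \<open>f\<close> is
  dominated pointwise by a countable sum of cylinder indicators, and measurability enters only for
  those. Exchanging sum and integral turns each indicator into a path weight.\<close>

lemma nn_integral_path_measure_le:
  assumes "\<And>\<sigma>. \<sigma> \<notin> Sigma_G M \<Longrightarrow> f \<sigma> = 0"
    and "\<And>es \<sigma>. es \<in> edge_lists M k \<Longrightarrow> \<sigma> \<in> cylinder M (map Some es) \<Longrightarrow> \<sigma> \<in> Sigma_G M \<Longrightarrow> f \<sigma> \<le> g es"
  shows "(\<integral>\<^sup>+\<sigma>. f \<sigma> \<partial>path_measure M x)
           \<le> (\<integral>\<^sup>+es. g es * ennreal (path_weight M es x) \<partial>count_space (edge_lists M k))"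
proof -
  let ?c = "\<lambda>es. cylinder M (map Some es)"
  have "(\<integral>\<^sup>+\<sigma>. f \<sigma> \<partial>path_measure M x)
      \<le> (\<integral>\<^sup>+\<sigma>. \<integral>\<^sup>+es. g es * indicator (?c es) \<sigma> \<partial>count_space (edge_lists M k) \<partial>path_measure M x)"
  proof (rule nn_integral_mono)
    fix \<sigma>
    show "f \<sigma> \<le> (\<integral>\<^sup>+es. g es * indicator (?c es) \<sigma> \<partial>count_space (edge_lists M k))"
    proof (cases "\<sigma> \<in> Sigma_G M")
      case True
      then obtain es where es: "es \<in> edge_lists M k" "\<sigma> \<in> ?c es"
        using ex_edge_list_cylinder by blast
      then have "f \<sigma> \<le> g es * indicator (?c es) \<sigma>" using assms(2) True by simp
      also have "\<dots> \<le> (\<integral>\<^sup>+es. g es * indicator (?c es) \<sigma> \<partial>count_space (edge_lists M k))"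
        by (rule nn_integral_ge_point[OF es(1)])
      finally show ?thesis .
    qed (simp add: assms(1))
  qed
  also have "\<dots> = (\<integral>\<^sup>+es. \<integral>\<^sup>+\<sigma>. g es * indicator (?c es) \<sigma> \<partial>path_measure M x \<partial>count_space (edge_lists M k))"
    by (rule nn_integral_count_space_nn_integral[OF countable_edge_lists])
       (use cylinder_sets in \<open>auto intro!: borel_measurable_times_ennreal borel_measurable_indicator\<close>)
  also have "\<dots> = (\<integral>\<^sup>+es. g es * ennreal (path_weight M es x) \<partial>count_space (edge_lists M k))"
    by (intro nn_integral_cong)
       (simp add: nn_integral_cmult_indicator cylinder_sets emeasure_path_measure_cylinder)
  finally show ?thesis .
qed

section \<open>Masses of the cells under iterates of the adjoint\<close>

text \<open>\<open>U_op\<close> fixes the constant 1, so applying \<open>U_adj\<close> cannot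
  increase the total mass.\<close>

lemma emeasure_U_adj_funpow_le:
  "emeasure ((U_adj M ^^ k) (return borel x)) UNIV \<le> 1"
proof (induction k)
  case (Suc k)
  let ?\<nu> = "(U_adj M ^^ k) (return borel x)"
  have "emeasure (U_adj M ?\<nu>) UNIV \<le> (\<integral>\<^sup>+x. 1 \<partial>?\<nu>)"
    using emeasure_U_adj_le[of M ?\<nu> UNIV] by (simp add: U_op_def infsum_wgt)
  also have "\<dots> = emeasure ?\<nu> UNIV"
    using sets_eq_imp_space_eq[OF sets_U_adj_funpow[of k M x]] by simp
  finally show ?case using Suc by simp
qed simp

lemma emeasure_U_adj_funpow_inaccessible:
  assumes "i \<in> Verts M" "x \<in> cell M i" "j \<in> Verts M" "\<not> accessible M k i j"
  shows "emeasure ((U_adj M ^^ k) (return borel x)) (cell M j) = 0"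
  using assms(3,4)
proof (induction k arbitrary: j)
  case 0
  then have "x \<notin> cell M j" using assms(1,2) cell_unique[of i j x] by (auto simp: accessible_def)
  then show ?case using cell_borel[OF 0(1)] by simp
next
  case (Suc k)
  let ?\<nu> = "(U_adj M ^^ k) (return borel x)"
  \<comment> \<open>By the induction hypothesis and countability this union is null; it remains to
    see that it contains every point where the integrand is nonzero.\<close>
  let ?N = "\<Union>l\<in>{l\<in>Verts M. \<not> accessible M k i l}. cell M l"
  have "?N \<in> null_sets ?\<nu>"
  proof (rule null_sets_UN')
    show "countable {l \<in> Verts M. \<not> accessible M k i l}"
      by (rule countable_subset[OF _ countable_Verts]) blast
    show "cell M l \<in> null_sets ?\<nu>" if "l \<in> {l \<in> Verts M. \<not> accessible M k i l}" for l
      using that Suc.IH[of l] cell_borel[of l] by (intro null_setsI) (auto simp: sets_U_adj_funpow)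
  qed
  moreover have "{z \<in> space ?\<nu>. \<not> U_op M (indicator (cell M j)) z = 0} \<subseteq> ?N"
  proof (rule subsetI)
    fix z assume "z \<in> {z \<in> space ?\<nu>. \<not> U_op M (indicator (cell M j)) z = 0}"
    then have "U_op M (indicator (cell M j)) z \<noteq> 0" by simp
    \<comment> \<open>A nonzero sum has a nonzero term: an edge from the cell of \<open>z\<close> to
      \<open>j\<close>. As \<open>j\<close> is inaccessible in \<open>Suc k\<close> steps, its
      initial vertex is inaccessible in \<open>k\<close>.\<close>
    then obtain e where e: "e \<in> Edges M" "ennreal (wgt M e z) * indicator (cell M j) (wmap M e z) \<noteq> 0"
      unfolding U_op_def by (meson infsum_0)
    then have z: "z \<in> cell M (ini M e)" "wmap M e z \<in> cell M j"
      using wgt_neq_0D[OF e(1), of z] by (cases "wgt M e z = 0"; simp add: indicator_def split: if_splits)+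
    then have "ter M e = j"
      using cell_unique[OF ter_in_Verts[OF e(1)] Suc.prems(1) wmap_in_cell[OF e(1)]] by blast
    then have "\<not> accessible M k i (ini M e)"
      using accessible_Suc[OF _ e(1) refl] Suc.prems(2) by blast
    then show "z \<in> ?N" using z ini_in_Verts[OF e(1)] by blast
  qed
  ultimately have "AE z in ?\<nu>. U_op M (indicator (cell M j)) z = 0" by (rule AE_I')
  then have "(\<integral>\<^sup>+z. U_op M (indicator (cell M j)) z \<partial>?\<nu>) = 0"
    by (subst nn_integral_cong_AE[where v="\<lambda>_. 0"]) auto
  then show ?case using emeasure_U_adj_le[of M ?\<nu> "cell M j"] by simp
qed

lemma nn_integral_U_adj_funpow_le:
  "(\<integral>\<^sup>+j. emeasure ((U_adj M ^^ k) (return borel x)) (cell M j) \<partial>count_space (Verts M)) \<le> 1"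
proof -
  let ?\<nu> = "(U_adj M ^^ k) (return borel x)"
  have "(\<integral>\<^sup>+j. emeasure ?\<nu> (cell M j) \<partial>count_space (Verts M)) = emeasure ?\<nu> (\<Union>j\<in>Verts M. cell M j)"
    by (rule emeasure_UN_countable[symmetric])
       (auto simp: sets_U_adj_funpow cell_borel countable_Verts cell_disjoint)
  also have "\<dots> \<le> 1" using emeasure_U_adj_funpow_le by (simp add: cell_cover)
  finally show ?thesis .
qed

section \<open>The mass of \<open>A_set\<close> over the cells\<close>

definition A_mass :: "real \<Rightarrow> real \<Rightarrow> nat \<Rightarrow> 'k \<Rightarrow> 'k \<Rightarrow> 'n \<Rightarrow> ennreal" where
  "A_mass a \<beta> k x y j =
     (\<integral>\<^sup>+\<sigma>\<in>A_set M a \<beta> k x y. indicator (cell M j) (wcomp M \<sigma> k x) \<partial>path_measure M x)"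

text \<open>At \<open>k = 0\<close> the set \<open>A\<^sub>x\<^sub>y\<close> may be all of \<open>\<Sigma>\<^sub>G\<close>, whence the disjunct \<open>k = 0\<close>.\<close>

definition exceeds :: "real \<Rightarrow> real \<Rightarrow> nat \<Rightarrow> 'k \<Rightarrow> 'k \<Rightarrow> 'e list \<Rightarrow> bool" where
  "exceeds a \<beta> k x y es \<longleftrightarrow> k = 0 \<or>
     dist (path_map M es x) (path_map M es y) > a powr (\<beta> * real k) * dist x y"

text \<open>On the cylinder of \<open>es\<close> the first \<open>k\<close> maps compose to
  \<open>path_map M es\<close>, so a sequence of \<open>A_set\<close> in it forces
  \<open>exceeds\<close> for the list.\<close>

lemma A_mass_le:
  "A_mass a \<beta> k x y j \<le> (\<integral>\<^sup>+es. indicator {es. exceeds a \<beta> k x y es \<and> path_map M es x \<in> cell M j} es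
      * ennreal (path_weight M es x) \<partial>count_space (edge_lists M k))"
  unfolding A_mass_def
proof (rule nn_integral_path_measure_le)
  show "\<sigma> \<notin> Sigma_G M \<Longrightarrow> indicator (cell M j) (wcomp M \<sigma> k x) * indicator (A_set M a \<beta> k x y) \<sigma> = (0::ennreal)" for \<sigma>
    by (auto simp: A_set_def)
  fix es \<sigma> assume es: "es \<in> edge_lists M k" "\<sigma> \<in> cylinder M (map Some es)"
  have "wcomp M \<sigma> k z = path_map M es z" for z
    using wcomp_cylinder[OF es(2)] es(1) by (auto simp: edge_lists_def)
  then show "indicator (cell M j) (wcomp M \<sigma> k x) * indicator (A_set M a \<beta> k x y) \<sigma>
      \<le> (indicator {es. exceeds a \<beta> k x y es \<and> path_map M es x \<in> cell M j} es :: ennreal)"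
    by (auto simp: A_set_def exceeds_def indicator_def)
qed

lemma A_mass_inaccessible:
  assumes "i \<in> Verts M" "x \<in> cell M i" "j \<in> Verts M" "\<not> accessible M k i j"
  shows "A_mass a \<beta> k x y j = 0"
proof -
  have "(\<integral>\<^sup>+es. indicator {es. exceeds a \<beta> k x y es \<and> path_map M es x \<in> cell M j} es
      * ennreal (path_weight M es x) \<partial>count_space (edge_lists M k)) = (\<integral>\<^sup>+es. 0 \<partial>count_space (edge_lists M k))"
  proof (intro nn_integral_cong)
    fix es assume "es \<in> space (count_space (edge_lists M k))"
    then show "indicator {es. exceeds a \<beta> k x y es \<and> path_map M es x \<in> cell M j} es
      * ennreal (path_weight M es x) = 0"
      using path_weight_neq_0D[of es x k i] assms cell_unique[of _ j "path_map M es x"]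
      by (cases "path_weight M es x = 0") (auto simp: indicator_def)
  qed
  then show ?thesis using A_mass_le[of a \<beta> k x y j] by simp
qed

text \<open>The cells partition the space, so every list ends in exactly one of them and summing
  over the vertices removes the end-point condition.\<close>

lemma nn_integral_A_mass_le_exceeds:
  "(\<integral>\<^sup>+j. A_mass a \<beta> k x y j \<partial>count_space (Verts M))
     \<le> (\<integral>\<^sup>+es. indicator {es. exceeds a \<beta> k x y es} es
          * ennreal (path_weight M es x) \<partial>count_space (edge_lists M k))"
proof -
  let ?h = "\<lambda>j es. indicator {es. exceeds a \<beta> k x y es \<and> path_map M es x \<in> cell M j} es
      * ennreal (path_weight M es x)"
  have "(\<integral>\<^sup>+j. A_mass a \<beta> k x y j \<partial>count_space (Verts M))
      \<le> (\<integral>\<^sup>+j. \<integral>\<^sup>+es. ?h j es \<partial>count_space (edge_lists M k) \<partial>count_space (Verts M))"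
    by (intro nn_integral_mono A_mass_le)
  also have "\<dots> = (\<integral>\<^sup>+es. \<integral>\<^sup>+j. ?h j es \<partial>count_space (Verts M) \<partial>count_space (edge_lists M k))"
    by (rule nn_integral_count_space_nn_integral[symmetric, OF countable_Verts]) simp
  also have "\<dots> = (\<integral>\<^sup>+es. indicator {es. exceeds a \<beta> k x y es} es
          * ennreal (path_weight M es x) \<partial>count_space (edge_lists M k))"
  proof (intro nn_integral_cong)
    fix es
    obtain l where l: "l \<in> Verts M" "path_map M es x \<in> cell M l" using cell_cover by blast
    have "(\<integral>\<^sup>+j. ?h j es \<partial>count_space (Verts M)) = (\<integral>\<^sup>+j. ?h j es \<partial>count_space {l})"
      by (rule nn_integral_count_space_eq) (use l cell_unique in \<open>auto simp: indicator_def\<close>)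
    also have "\<dots> = indicator {es. exceeds a \<beta> k x y es} es * ennreal (path_weight M es x)"
      using l by (simp add: nn_integral_count_space_finite indicator_def)
    finally show "(\<integral>\<^sup>+j. ?h j es \<partial>count_space (Verts M))
        = indicator {es. exceeds a \<beta> k x y es} es * ennreal (path_weight M es x)" .
  qed
  finally show ?thesis .
qed

text \<open>Markov's inequality for the distance at time \<open>k\<close>, with threshold
  \<open>a powr (\<beta> * real k) * dist x y\<close> and mean at most
  \<open>a ^ k * dist x y\<close>.\<close>

lemma nn_integral_A_mass_le:
  assumes "contractive_system M a" "i \<in> Verts M" "x \<in> cell M i" "y \<in> cell M i"
  shows "(\<integral>\<^sup>+j. A_mass a \<beta> k x y j \<partial>count_space (Verts M)) \<le> ennreal (a powr ((1 - \<beta>) * real k))"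
proof -
  have a: "0 < a" using assms(1) by (simp add: contractive_system_def)
  let ?r = "a powr (\<beta> * real k) * dist x y"
  have "(\<integral>\<^sup>+es. indicator {es. exceeds a \<beta> k x y es} es
          * ennreal (path_weight M es x) \<partial>count_space (edge_lists M k)) \<le> ennreal (a powr ((1 - \<beta>) * real k))"
  proof (cases "k = 0")
    \<comment> \<open>At time 0 the claimed bound is 1, which the total weight already
      satisfies.\<close>
    case True
    have "(\<integral>\<^sup>+es. indicator {es. exceeds a \<beta> k x y es} es
          * ennreal (path_weight M es x) \<partial>count_space (edge_lists M k))
        \<le> (\<integral>\<^sup>+es. ennreal (path_weight M es x) \<partial>count_space (edge_lists M k))"
      by (intro nn_integral_mono) (auto simp: indicator_def)
    also have "\<dots> \<le> 1" by (rule nn_integral_path_weight_le)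
    finally show ?thesis using True a by simp
  next
    case k: False
    show ?thesis
    \<comment> \<open>For equal points both distances are 0 and the strict inequality in
      \<open>exceeds\<close> fails; otherwise the threshold is positive and can be divided
      by.\<close>
    proof (cases "x = y")
      case True
      then show ?thesis using k by (simp add: exceeds_def)
    next
      case False
      then have r: "?r > 0" using a by simp
      have "(\<integral>\<^sup>+es. indicator {es. exceeds a \<beta> k x y es} es
          * ennreal (path_weight M es x) \<partial>count_space (edge_lists M k))
        \<le> (\<integral>\<^sup>+es. ennreal (inverse ?r) * ennreal (path_weight M es x
              * dist (path_map M es x) (path_map M es y)) \<partial>count_space (edge_lists M k))"
      proof (intro nn_integral_mono)
        fix es assume "es \<in> space (count_space (edge_lists M k))"
        then have w: "path_weight M es x \<ge> 0" using path_weight_nonneg by auto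
        let ?d = "dist (path_map M es x) (path_map M es y)"
        show "indicator {es. exceeds a \<beta> k x y es} es * ennreal (path_weight M es x)
            \<le> ennreal (inverse ?r) * ennreal (path_weight M es x * ?d)"
        proof (cases "exceeds a \<beta> k x y es")
          case True
          then have "1 \<le> ?d / ?r" using k r by (simp add: exceeds_def)
          then have "path_weight M es x * 1 \<le> path_weight M es x * (?d / ?r)"
            using w by (rule mult_left_mono)
          then show ?thesis using True w r
            by (auto simp: ennreal_mult'[symmetric] divide_inverse mult_ac intro!: ennreal_leI)
        qed simp
      qed
      also have "\<dots> = ennreal (inverse ?r) * (\<integral>\<^sup>+es. ennreal (path_weight M es x
              * dist (path_map M es x) (path_map M es y)) \<partial>count_space (edge_lists M k))"
        by (rule nn_integral_cmult) simp
      also have "\<dots> \<le> ennreal (inverse ?r) * ennreal (a ^ k * dist x y)"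
        by (intro mult_left_mono nn_integral_path_weight_dist_le[OF assms]) simp
      also have "\<dots> = ennreal (inverse ?r * (a ^ k * dist x y))"
        using r by (intro ennreal_mult'[symmetric]) simp
      also have "inverse ?r * (a ^ k * dist x y) = a powr ((1 - \<beta>) * real k)"
        using a False by (simp add: powr_realpow[symmetric] powr_diff left_diff_distrib field_simps)
      finally show ?thesis .
    qed
  qed
  then show ?thesis using nn_integral_A_mass_le_exceeds by (rule order_trans[rotated])
qed

text \<open>Along lists of nonzero weight the distance at time \<open>k\<close> is at most
  \<open>a ^ k * dist x y\<close>, which is within the threshold, so no such list exceeds
  it.\<close>

lemma A_mass_eq_0:
  assumes contr: "\<forall>e\<in>Edges M. \<forall>u\<in>cell M (ini M e). \<forall>v\<in>cell M (ini M e).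
              dist (wmap M e u) (wmap M e v) \<le> a * dist u v"
    and a: "0 < a" "a < 1" and "\<beta> \<le> 1"
    and "i \<in> Verts M" "x \<in> cell M i" "y \<in> cell M i"
  shows "A_mass a \<beta> k x y j = 0"
proof (cases "k = 0")
  case True
  have "a-lipschitz_on (cell M (ini M e)) (wmap M e)" if "e \<in> Edges M" for e
    using contr a that by (auto intro!: lipschitz_onI)
  \<comment> \<open>The Lipschitz constant \<open>a\<close> below 1 rules out the case in which the
    set at time 0 is all of \<open>Sigma_G\<close>.\<close>
  then have "A_set M a \<beta> 0 x y = {}" using a by (auto simp: A_set_def)
  then show ?thesis by (simp add: A_mass_def True)
next
  case False
  have "(\<integral>\<^sup>+es. indicator {es. exceeds a \<beta> k x y es \<and> path_map M es x \<in> cell M j} es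
      * ennreal (path_weight M es x) \<partial>count_space (edge_lists M k)) = (\<integral>\<^sup>+es. 0 \<partial>count_space (edge_lists M k))"
  proof (intro nn_integral_cong)
    fix es assume "es \<in> space (count_space (edge_lists M k))"
    then have es: "es \<in> edge_lists M k" by simp
    have "a ^ k = a powr real k" using a by (simp add: powr_realpow)
    \<comment> \<open>As \<open>a < 1\<close>, the smaller exponent gives the larger power.\<close>
    also have "\<dots> \<le> a powr (\<beta> * real k)"
      using a assms(4) by (intro powr_mono') (auto intro: mult_left_le_one_le mult_right_mono[of \<beta> 1 "real k", simplified])
    finally have "a ^ k * dist x y \<le> a powr (\<beta> * real k) * dist x y" by (rule mult_right_mono) simp
    then have "\<not> exceeds a \<beta> k x y es" if "path_weight M es x \<noteq> 0"
      using dist_path_map_le[OF contr _ that es assms(5-)] a False by (simp add: exceeds_def)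
    then show "indicator {es. exceeds a \<beta> k x y es \<and> path_map M es x \<in> cell M j} es
      * ennreal (path_weight M es x) = 0"
      by (cases "path_weight M es x = 0") auto
  qed
  then show ?thesis using A_mass_le[of a \<beta> k x y j] by simp
qed

section \<open>Termwise comparison of the series\<close>

lemma B_sum_eq:
  "B_sum M a \<beta> x y =
     (\<Sum>k. (\<integral>\<^sup>+j. ell M j * A_mass a \<beta> k x y j \<partial>count_space (Verts M))
        + (\<integral>\<^sup>+j. phi_vert M a \<beta> k x y j * emeasure ((U_adj M ^^ k) (return borel x)) (cell M j)
            \<partial>count_space (Verts M)))"
  by (simp add: B_sum_def A_mass_def[symmetric] infsum_eq_nn_integral_count_space[OF countable_Verts]
      nn_integral_add)

text \<open>Every \<open>phi_edge\<close> is at most \<open>phi_system\<close>, which depends on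
  neither the edge nor \<open>z\<close> and so comes out of the sum; what remains is the sum in
  \<open>ell\<close>.\<close>

lemma phi_vert_le:
  "phi_vert M a \<beta> k x y j \<le> ell M j * (phi_system M (a powr (\<beta> * real k) * dist x y))\<^sup>2"
  unfolding phi_vert_def
proof (rule SUP_least)
  fix z assume z: "z \<in> cell M j"
  let ?s = "a powr (\<beta> * real k) * dist x y" and ?O = "out_edges M j"
  have O: "countable ?O"
    using countable_Edges by (auto simp: out_edges_def intro: countable_subset)
  have "(\<Sum>\<^sub>\<infinity>e\<in>?O. (phi_edge M e ?s)\<^sup>2 / ennreal (wgt M e z))
      \<le> (\<integral>\<^sup>+e. (phi_system M ?s)\<^sup>2 * (1 / ennreal (wgt M e z)) \<partial>count_space ?O)"
    unfolding infsum_eq_nn_integral_count_space[OF O]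
  proof (rule nn_integral_mono)
    fix e assume "e \<in> space (count_space ?O)"
    then have "phi_edge M e ?s \<le> phi_system M ?s"
      by (auto simp: phi_system_def out_edges_def intro: SUP_upper)
    then show "(phi_edge M e ?s)\<^sup>2 / ennreal (wgt M e z) \<le> (phi_system M ?s)\<^sup>2 * (1 / ennreal (wgt M e z))"
      \<comment> \<open>Division in \<open>ennreal\<close> is multiplication by the inverse, so
        monotonicity covers zero weights without a case split.\<close>
      unfolding divide_ennreal_def mult_1 by (intro mult_right_mono power_mono) auto
  qed
  also have "\<dots> = (phi_system M ?s)\<^sup>2 * (\<Sum>\<^sub>\<infinity>e\<in>?O. 1 / ennreal (wgt M e z))"
    unfolding infsum_eq_nn_integral_count_space[OF O] by (rule nn_integral_cmult) simp
  also have "\<dots> \<le> (phi_system M ?s)\<^sup>2 * ell M j"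
    unfolding ell_def by (intro mult_left_mono SUP_upper z) simp
  finally show "(\<Sum>\<^sub>\<infinity>e\<in>?O. (phi_edge M e ?s)\<^sup>2 / ennreal (wgt M e z)) \<le> ell M j * (phi_system M ?s)\<^sup>2"
    by (simp add: mult.commute)
qed

lemma phi_hat_le:
  "phi_hat M a \<beta> i k x y \<le> ell_hat M i k * (phi_system M (a powr (\<beta> * real k) * dist x y))\<^sup>2"
  unfolding phi_hat_def
proof (rule Sup_least, safe)
  fix j assume "accessible M k i j"
  then have "ell M j \<le> ell_hat M i k" unfolding ell_hat_def by (intro Sup_upper) auto
  then show "phi_vert M a \<beta> k x y j \<le> ell_hat M i k * (phi_system M (a powr (\<beta> * real k) * dist x y))\<^sup>2"
    using phi_vert_le by (blast intro: order_trans mult_right_mono zero_le)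
qed

end

theorem proposition1:
  fixes M :: "('k::complete_space, 'e, 'n) markov_data"
    and a \<beta> :: real and x y :: 'k and i :: 'n
  assumes "Markov_system M" and "positive_system M" and "contractive_system M a"
    and "i \<in> Verts M" and "x \<in> cell M i" and "y \<in> cell M i"
    and "0 \<le> \<beta>" and "\<beta> \<le> 1"
  shows "B_sum M a \<beta> x y
           \<le> (\<Sum>k. ell_hat M i k * ennreal (a powr ((1 - \<beta>) * real k)) + phi_hat M a \<beta> i k x y)
       \<and> B_sum M a \<beta> x y
           \<le> (\<Sum>k. ell_hat M i k *
                (ennreal (a powr ((1 - \<beta>) * real k))
                 + (phi_system M (a powr (\<beta> * real k) * dist x y))\<^sup>2))
       \<and> ((\<forall>e\<in>Edges M. \<forall>u\<in>cell M (ini M e). \<forall>v\<in>cell M (ini M e).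
              dist (wmap M e u) (wmap M e v) \<le> a * dist u v)
           \<longrightarrow> B_sum M a \<beta> x y
             \<le> (\<Sum>k. ell_hat M i k * (phi_system M (a powr (\<beta> * real k) * dist x y))\<^sup>2))"
proof -
  interpret Markov_system M by fact
  have a: "0 < a" "a < 1" using assms(3) by (auto simp: contractive_system_def)
  let ?L = "\<lambda>k. \<integral>\<^sup>+j. ell M j * A_mass a \<beta> k x y j \<partial>count_space (Verts M)"
  let ?F = "\<lambda>k. \<integral>\<^sup>+j. phi_vert M a \<beta> k x y j * emeasure ((U_adj M ^^ k) (return borel x)) (cell M j)
      \<partial>count_space (Verts M)"
  let ?p = "\<lambda>k. (phi_system M (a powr (\<beta> * real k) * dist x y))\<^sup>2"
  have L: "?L k \<le> ell_hat M i k * ennreal (a powr ((1 - \<beta>) * real k))" for k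
    unfolding ell_hat_def
    by (rule nn_integral_count_space_weighted_le[OF A_mass_inaccessible[OF assms(4,5)] nn_integral_A_mass_le[OF assms(3-6)]])
  \<comment> \<open>The total mass is at most 1, so the bound is the supremum itself.\<close>
  have F: "?F k \<le> phi_hat M a \<beta> i k x y" for k
    using nn_integral_count_space_weighted_le[OF emeasure_U_adj_funpow_inaccessible[OF assms(4,5)] nn_integral_U_adj_funpow_le]
    by (simp add: phi_hat_def)
  have i: "B_sum M a \<beta> x y
      \<le> (\<Sum>k. ell_hat M i k * ennreal (a powr ((1 - \<beta>) * real k)) + phi_hat M a \<beta> i k x y)"
    unfolding B_sum_eq by (intro suminf_le add_mono L F) auto
  \<comment> \<open>The second bound follows from the first term by term through
    \<open>phi_hat_le\<close>.\<close>
  also have "\<dots> \<le> (\<Sum>k. ell_hat M i k * (ennreal (a powr ((1 - \<beta>) * real k)) + ?p k))"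
    unfolding distrib_left by (intro suminf_le add_mono phi_hat_le) auto
  finally have ii: "B_sum M a \<beta> x y \<le> (\<Sum>k. ell_hat M i k * (ennreal (a powr ((1 - \<beta>) * real k)) + ?p k))" .
  have iii: "B_sum M a \<beta> x y \<le> (\<Sum>k. ell_hat M i k * ?p k)"
    if contr: "\<forall>e\<in>Edges M. \<forall>u\<in>cell M (ini M e). \<forall>v\<in>cell M (ini M e).
              dist (wmap M e u) (wmap M e v) \<le> a * dist u v"
  proof -
    \<comment> \<open>With no mass on \<open>A_set\<close>, only the part of each term with
      \<open>phi_vert\<close> survives.\<close>
    have "?L k = 0" for k
      using A_mass_eq_0[OF contr a assms(8,4,5,6)] by simp
    then show ?thesis
      unfolding B_sum_eq using order_trans[OF F phi_hat_le] by (intro suminf_le) auto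
  qed
  show ?thesis using i ii iii by blast
qed

end
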